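(* In $\mathbb R^3$ with the standard contact structure $\xi_{\mathrm{std}}$ and metric $g_{\mathrm{std}}$, let $H=\mathbb R^2\times\{0\}$, let $T>0$, and let $\mathcal A_T(H)$ be the attainable set of $H$ at time $T$. Then the two components of $\partial\mathcal A_T(H)$ are graphical over $H$ and smooth away from the points lying vertically over the origin (i.e. on the $z$-axis). Additionally, $$\partial\mathcal A_T(H)=\tau\circ\phi_T\bigl(\mathrm{Ann}(TH)|_{\{r\ge 2T/\pi\}}\cap S\bigr),$$ where $\phi_T$ is the time-$T$ flow of the maximised Hamiltonian, $r$ is the distance to the $z$-axis, $S$ is its unit level set and $\tau:T^*\mathbb R^3\to\mathbb R^3$ is the bundle projection.
   Context: On $\mathbb R^3$ with cylindrical coordinates $(r,\theta,z)$ let $\alpha=dz-\tfrac12(x\,dy-y\,dx)=dz-\tfrac12r^2d\theta$, $\xi_{\mathrm{std}}=\ker\alpha$, and $g_{\mathrm{std}}=dx^2+dy^2$ restricted to $\xi_{\mathrm{std}}$. Write covectors as $\lambda=a\alpha+b\,dx+c\,dy$; the maximised Hamiltonian (dual norm) is $\lambda\mapsto\sqrt{b^2+c^2}$, and $S=\{b^2+c^2=1\}$. $\mathrm{Ann}(TH)|_{\{r\ge r_0\}}$ denotes the covectors based at points of $H$ with $r\ge r_0$ that annihilate $TH$ (multiples of $dz$). The attainable set $\mathcal A_T(H)$ is the set of endpoints $\gamma(T)$ of Lipschitz curves $\gamma:[0,T]\to\mathbb R^3$ with $\gamma(0)\in H$, $\dot\gamma\in\xi_{\mathrm{std}}$ and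 $g_{\mathrm{std}}(\dot\gamma,\dot\gamma)\le1$ almost everywhere. *)

theory Defs
  imports "HOL-Analysis.Analysis"
begin

section \<open>The standard contact structure\<close>

text \<open>A point \<open>q :: real^3\<close> has coordinates \<open>x = q $ 1\<close>, \<open>y = q $ 2\<close>, \<open>z = q $ 3\<close>;
  all tangent spaces are identified with \<open>real^3\<close>.\<close>

text \<open>The value of \<open>dz - 1/2 (x dy - y dx)\<close> at the point \<open>q\<close> on the tangent vector \<open>v\<close>.\<close>

definition contact_form :: "real^3 \<Rightarrow> real^3 \<Rightarrow> real" where
  "contact_form q v = v $ 3 - (1/2) * (q $ 1 * v $ 2 - q $ 2 * v $ 1)"

definition xi_std :: "real^3 \<Rightarrow> (real^3) set" where
  "xi_std q = {v. contact_form q v = 0}"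

definition g_std :: "real^3 \<Rightarrow> real^3 \<Rightarrow> real" where
  "g_std u v = u $ 1 * v $ 1 + u $ 2 * v $ 2"

definition cyl_radius :: "real^3 \<Rightarrow> real" where
  "cyl_radius q = sqrt ((q $ 1)\<^sup>2 + (q $ 2)\<^sup>2)"

definition plane_H :: "(real^3) set" where
  "plane_H = {q. q $ 3 = 0}"

definition attainable_set :: "(real^3) set \<Rightarrow> real \<Rightarrow> (real^3) set" where
  "attainable_set A T = {\<gamma> T | \<gamma>.
     (\<exists>L. L-lipschitz_on {0..T} \<gamma>) \<and> \<gamma> 0 \<in> A \<and>
     (AE t in lebesgue_on {0..T}. \<exists>v. (\<gamma> has_vector_derivative v) (at t within {0..T}) \<and>
        v \<in> xi_std (\<gamma> t) \<and> g_std v v \<le> 1)}"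

section \<open>The cotangent bundle and Hamiltonian flows\<close>

type_synonym cotangent = "(real^3) \<times> ((real^3) \<Rightarrow>\<^sub>L real)"

text \<open>The bundle projection \<open>\<tau>\<close> is \<open>fst\<close> on this type.\<close>

text \<open>\<open>is_hamiltonian_vector h w X\<close> says that \<open>h\<close> is differentiable at \<open>w\<close> and \<open>X\<close> is the value
  there of its Hamiltonian vector field: for \<open>X = (u, \<nu>)\<close>, the differential of \<open>h\<close> at \<open>w\<close> is
  \<open>(v, \<mu>) \<mapsto> \<mu> u - \<nu> v\<close>, i.e. in canonical coordinates \<open>q' = \<partial>h/\<partial>p\<close> and \<open>p' = - \<partial>h/\<partial>q\<close>.\<close>

definition is_hamiltonian_vector :: "(cotangent \<Rightarrow> real) \<Rightarrow> cotangent \<Rightarrow> cotangent \<Rightarrow> bool" where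
  "is_hamiltonian_vector h w X \<longleftrightarrow>
     (h has_derivative (\<lambda>(v, \<mu>). blinfun_apply \<mu> (fst X) - blinfun_apply (snd X) v)) (at w)"

definition hamiltonian_curve :: "(cotangent \<Rightarrow> real) \<Rightarrow> real \<Rightarrow> (real \<Rightarrow> cotangent) \<Rightarrow> bool" where
  "hamiltonian_curve h T \<eta> \<longleftrightarrow>
     (\<forall>t\<in>{0..T}. \<exists>X. is_hamiltonian_vector h (\<eta> t) X \<and>
        (\<eta> has_vector_derivative X) (at t within {0..T}))"

text \<open>The forward flow (\<open>T \<ge> 0\<close>); it is meaningful at those \<open>w\<close> from which there is a unique
  integral curve on \<open>{0..T}\<close>.\<close>

definition hamiltonian_flow :: "(cotangent \<Rightarrow> real) \<Rightarrow> real \<Rightarrow> cotangent \<Rightarrow> cotangent" where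
  "hamiltonian_flow h T w = (THE w'. \<exists>\<eta>. hamiltonian_curve h T \<eta> \<and> \<eta> 0 = w \<and> \<eta> T = w')"

definition max_hamiltonian :: "cotangent \<Rightarrow> real" where
  "max_hamiltonian w =
     Sup {blinfun_apply (snd w) v | v. v \<in> xi_std (fst w) \<and> g_std v v \<le> 1}"

definition unit_level_set :: "cotangent set" where
  "unit_level_set = {w. max_hamiltonian w = 1}"

definition Ann_TH :: "real \<Rightarrow> cotangent set" where
  "Ann_TH r0 = {(q, l). q \<in> plane_H \<and> cyl_radius q \<ge> r0 \<and>
     (\<forall>v. v $ 3 = 0 \<longrightarrow> blinfun_apply l v = 0)}"

text \<open>For a covector \<open>a \<alpha> + b dx + c dy\<close> at \<open>q\<close>, with \<open>\<alpha>\<close> the contact form, the maximised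
  Hamiltonian is \<open>sqrt (b\<^sup>2 + c\<^sup>2)\<close>.\<close>

lemma max_hamiltonian_eq:
  assumes l: "\<And>v. blinfun_apply l v = a * contact_form q v + b * v $ 1 + c * v $ 2"
  shows "max_hamiltonian (q, l) = sqrt (b\<^sup>2 + c\<^sup>2)"
proof -
  let ?V = "{blinfun_apply l v | v. v \<in> xi_std q \<and> g_std v v \<le> 1}"
  let ?n = "sqrt (b\<^sup>2 + c\<^sup>2)"
  have "Sup ?V = ?n"
  proof (rule cSup_eq_maximum)
    let ?v = "vector [b / ?n, c / ?n, (1/2) * (q $ 1 * (c / ?n) - q $ 2 * (b / ?n))] :: real^3"
    have nn: "?n * ?n = b * b + c * c"
      by (simp add: power2_eq_square)
    have "?v \<in> xi_std q"
      by (simp add: xi_std_def contact_form_def)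
    moreover have "g_std ?v ?v \<le> 1"
      using nn by (cases "?n = 0") (simp_all add: g_std_def add_divide_distrib [symmetric])
    moreover have "blinfun_apply l ?v = ?n"
    proof -
      have "blinfun_apply l ?v = (b * b + c * c) / ?n"
        using \<open>?v \<in> xi_std q\<close> by (simp add: l xi_std_def add_divide_distrib)
      also have "\<dots> = ?n"
        by (simp add: real_div_sqrt flip: power2_eq_square)
      finally show ?thesis .
    qed
    ultimately show "?n \<in> ?V"
      by force
  next
    fix s assume "s \<in> ?V"
    then obtain v :: "real^3" where s: "s = b * v $ 1 + c * v $ 2" and v: "(v $ 1)\<^sup>2 + (v $ 2)\<^sup>2 \<le> 1"
      by (auto simp: l xi_std_def g_std_def power2_eq_square)
    have "s\<^sup>2 \<le> (b\<^sup>2 + c\<^sup>2) * ((v $ 1)\<^sup>2 + (v $ 2)\<^sup>2)"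
      using zero_le_power2 [of "b * v $ 2 - c * v $ 1"]
      by (simp add: s power2_eq_square algebra_simps)
    also have "\<dots> \<le> b\<^sup>2 + c\<^sup>2"
      using v by (simp add: mult_left_le)
    finally show "s \<le> ?n"
      by (rule real_le_rsqrt)
  qed
  then show ?thesis
    by (simp add: max_hamiltonian_def)
qed

section \<open>Smooth functions\<close>

text \<open>\<open>Ck_on k f U\<close> is meant for open \<open>U\<close>.\<close>

fun Ck_on :: "nat \<Rightarrow> ('a::euclidean_space \<Rightarrow> real) \<Rightarrow> 'a set \<Rightarrow> bool" where
  "Ck_on 0 f U \<longleftrightarrow> continuous_on U f"
| "Ck_on (Suc k) f U \<longleftrightarrow>
     (\<forall>x\<in>U. f differentiable (at x)) \<and>
     (\<forall>v. Ck_on k (\<lambda>x. frechet_derivative f (at x) v) U)"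

definition smooth_on :: "('a::euclidean_space \<Rightarrow> real) \<Rightarrow> 'a set \<Rightarrow> bool" where
  "smooth_on f U \<longleftrightarrow> (\<forall>k. Ck_on k f U)"

definition graph_over_H :: "(real^2 \<Rightarrow> real) \<Rightarrow> (real^3) set" where
  "graph_over_H f = {q. q $ 3 = f (vector [q $ 1, q $ 2])}"

end

theory Submission
  imports Defs
begin

text \<open>
  Along a horizontal curve starting in \<open>H\<close> the height \<open>z\<close> is the area swept from the origin by the
  planar projection, so the problem is a Dido problem with free initial point. For every
  \<open>r > 2 T / pi\<close> the function \<open>r t / 4 + tan (t / r) (x\<^sup>2 + y\<^sup>2) / 4\<close> solves a Riccati equation that
  turns the difference between its rate of change and \<open>\<bar>z'\<bar>\<close> into a sum of squares; hence
  \<open>\<bar>z\<bar> \<le> r T / 4 + tan (T / r) \<rho>\<^sup>2 / 4\<close> at a point of \<open>\<A>\<^sub>T(H)\<close> at distance \<open>\<rho>\<close> from the axis.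
  Equality holds for the value of \<open>r\<close> with \<open>r cos (T / r) = \<rho>\<close>, on an arc of a circle of diameter
  \<open>r\<close> through the origin. These arcs are exactly the projections of the integral curves of the
  maximised Hamiltonian starting in the unit conormal covectors over \<open>{r \<ge> 2 T / pi}\<close>. Since
  \<open>r \<mapsto> r cos (T / r)\<close> is expanding there, its inverse is Lipschitz and satisfies a differential
  equation from which the smoothness of the boundary graphs follows.\<close>

section \<open>Calculus of \<open>Ck_on\<close>\<close>

lemma Ck_on_cong:
  assumes "open U" "\<And>x. x \<in> U \<Longrightarrow> f x = g x"
  shows "Ck_on k f U \<longleftrightarrow> Ck_on k g U"
  using assms(2)
proof (induction k arbitrary: f g)
  case 0
  then show ?case
    by (auto cong: continuous_on_cong)
next
  case (Suc k)
  have iff: "(f has_derivative D) (at x) \<longleftrightarrow> (g has_derivative D) (at x)" if "x \<in> U" for x D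
    using has_derivative_transform_within_open [OF _ \<open>open U\<close> that, of f D UNIV g]
      has_derivative_transform_within_open [OF _ \<open>open U\<close> that, of g D UNIV f] Suc.prems by auto
  then have "f differentiable (at x) \<longleftrightarrow> g differentiable (at x)"
    and "frechet_derivative f (at x) = frechet_derivative g (at x)" if "x \<in> U" for x
    using that by (simp_all add: differentiable_def frechet_derivative_def)
  then show ?case
    using Suc.IH [of "\<lambda>x. frechet_derivative f (at x) _" "\<lambda>x. frechet_derivative g (at x) _"]
    by simp
qed

text \<open>Lets an explicit formula for the derivative replace \<open>frechet_derivative\<close> in
  the recursion; since \<open>U\<close> is open, only its values on \<open>U\<close> matter.\<close>

lemma Ck_on_Suc_has_derivative:
  assumes "open U" "\<And>x. x \<in> U \<Longrightarrow> (f has_derivative f' x) (at x)"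
  shows "Ck_on (Suc k) f U \<longleftrightarrow> (\<forall>v. Ck_on k (\<lambda>x. f' x v) U)"
proof -
  have "Ck_on k (\<lambda>x. frechet_derivative f (at x) v) U \<longleftrightarrow> Ck_on k (\<lambda>x. f' x v) U" for v
    using frechet_derivative_at [OF assms(2)]
    by (intro Ck_on_cong [OF \<open>open U\<close>]) simp
  moreover have "f differentiable (at x)" if "x \<in> U" for x
    using assms(2) [OF that] by (auto simp: differentiable_def)
  ultimately show ?thesis
    by simp
qed

lemma Ck_on_SucD: "Ck_on (Suc k) f U \<Longrightarrow> Ck_on k f U"
proof (induction k arbitrary: f)
  case 0
  then show ?case
    by (auto intro!: continuous_at_imp_continuous_on differentiable_imp_continuous_within)
next
  case (Suc k)
  then show ?case
    by (metis Ck_on.simps(2))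
qed

lemma Ck_on_const: "Ck_on k (\<lambda>x. c) U"
  by (induction k arbitrary: c) (auto simp: frechet_derivative_const)

lemma Ck_on_linear:
  assumes "bounded_linear f"
  shows "Ck_on k f U"
proof (cases k)
  case 0
  then show ?thesis
    by (simp add: linear_continuous_on assms)
next
  case (Suc j)
  have "(f has_derivative f) (at x)" for x
    by (rule bounded_linear_imp_has_derivative [OF assms])
  then have "frechet_derivative f (at x) = f" "f differentiable (at x)" for x
    by (metis frechet_derivative_at, auto simp: differentiable_def)
  then show ?thesis
    by (simp add: Suc Ck_on_const)
qed

lemma Ck_on_add:
  assumes "open U" "Ck_on k f U" "Ck_on k g U"
  shows "Ck_on k (\<lambda>x. f x + g x) U"
  using assms(2,3)
proof (induction k arbitrary: f g)
  case 0
  then show ?case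
    by (simp add: continuous_on_add)
next
  case (Suc k)
  then have "((\<lambda>x. f x + g x) has_derivative
      (\<lambda>v. frechet_derivative f (at x) v + frechet_derivative g (at x) v)) (at x)" if "x \<in> U" for x
    using that by (intro has_derivative_add) (auto simp: frechet_derivative_works)
  with Suc show ?case
    by (subst Ck_on_Suc_has_derivative [OF \<open>open U\<close>]) (auto intro: Suc.IH)
qed

lemma Ck_on_mult:
  assumes "open U" "Ck_on k f U" "Ck_on k g U"
  shows "Ck_on k (\<lambda>x. f x * g x) U"
  using assms(2,3)
proof (induction k arbitrary: f g)
  case 0
  then show ?case
    by (simp add: continuous_on_mult)
next
  case (Suc k)
  then have "((\<lambda>x. f x * g x) has_derivative
      (\<lambda>v. f x * frechet_derivative g (at x) v + frechet_derivative f (at x) v * g x)) (at x)"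
    if "x \<in> U" for x
    using that by (intro has_derivative_mult) (auto simp: frechet_derivative_works)
  with Suc.prems Suc.prems [THEN Ck_on_SucD] show ?case
    by (subst Ck_on_Suc_has_derivative [OF \<open>open U\<close>])
      (auto intro!: Suc.IH Ck_on_add [OF \<open>open U\<close>])
qed

lemma Ck_on_minus:
  assumes "open U" "Ck_on k f U"
  shows "Ck_on k (\<lambda>x. - f x) U"
  using Ck_on_mult [OF assms(1) Ck_on_const [of k "-1"] assms(2)] by simp

lemma Ck_on_inverse:
  assumes "open U" "Ck_on k f U" "\<And>x. x \<in> U \<Longrightarrow> f x \<noteq> 0"
  shows "Ck_on k (\<lambda>x. inverse (f x)) U"
  using assms(2)
proof (induction k)
  case 0
  then show ?case
    using assms(3) by (auto intro: continuous_on_inverse)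
next
  case (Suc k)
  then have "((\<lambda>x. inverse (f x)) has_derivative
      (\<lambda>v. - (inverse (f x) * frechet_derivative f (at x) v * inverse (f x)))) (at x)"
    if "x \<in> U" for x
    using that assms(3) by (intro Deriv.has_derivative_inverse) (auto simp: frechet_derivative_works)
  moreover have "Ck_on k (\<lambda>x. - (inverse (f x) * frechet_derivative f (at x) v * inverse (f x))) U" for v
    using Suc.prems Suc.IH [OF Ck_on_SucD [OF Suc.prems]]
    by (intro Ck_on_mult Ck_on_minus \<open>open U\<close>) auto
  ultimately show ?case
    by (subst Ck_on_Suc_has_derivative [OF \<open>open U\<close>]) auto
qed

text \<open>Both functions go through one joint induction, because the derivative of each involves
  the other one order lower.\<close>

lemma Ck_on_sin_cos:
  assumes "open U" "Ck_on k f U"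
  shows Ck_on_sin: "Ck_on k (\<lambda>x. sin (f x)) U" and Ck_on_cos: "Ck_on k (\<lambda>x. cos (f x)) U"
proof -
  from assms(2) have "Ck_on k (\<lambda>x. sin (f x)) U \<and> Ck_on k (\<lambda>x. cos (f x)) U"
  proof (induction k)
    case 0
    then show ?case
      by (auto intro: continuous_on_sin continuous_on_cos)
  next
    case (Suc k)
    have f: "(f has_derivative frechet_derivative f (at x)) (at x)" if "x \<in> U" for x
      using that Suc.prems by (auto simp: frechet_derivative_works)
    have s: "((\<lambda>x. sin (f x)) has_derivative (\<lambda>v. cos (f x) * frechet_derivative f (at x) v)) (at x)"
      and c: "((\<lambda>x. cos (f x)) has_derivative (\<lambda>v. - (sin (f x) * frechet_derivative f (at x) v))) (at x)"
      if "x \<in> U" for x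
      by (rule derivative_eq_intros f [OF that] refl | simp add: algebra_simps)+
    show ?case
      using Suc.prems Suc.IH [OF Ck_on_SucD [OF Suc.prems]]
      by (auto simp: Ck_on_Suc_has_derivative [OF \<open>open U\<close> s] Ck_on_Suc_has_derivative [OF \<open>open U\<close> c]
          simp del: Ck_on.simps(2) intro!: Ck_on_mult Ck_on_minus \<open>open U\<close>)
         (simp_all add: Ck_on.simps(2))
  qed
  then show "Ck_on k (\<lambda>x. sin (f x)) U" "Ck_on k (\<lambda>x. cos (f x)) U"
    by auto
qed

text \<open>If the derivative of \<open>f\<close> is as smooth as \<open>f\<close> itself, each
  order of smoothness yields the next. This serves functions known through a differential
  equation.\<close>

lemma Ck_on_bootstrap:
  assumes "open U" "\<And>x. x \<in> U \<Longrightarrow> (f has_derivative f' x) (at x)"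
    and "\<And>j v. Ck_on j f U \<Longrightarrow> Ck_on j (\<lambda>x. f' x v) U"
  shows "Ck_on k f U"
proof (induction k)
  case 0
  show ?case
    using assms(2) by (auto intro: has_derivative_continuous_on has_derivative_at_withinI)
next
  case (Suc k)
  then show ?case
    by (simp add: Ck_on_Suc_has_derivative [OF assms(1,2)] assms(3) del: Ck_on.simps)
qed

lemma Ck_on_norm: "Ck_on k norm (UNIV - {0 :: 'a::euclidean_space})"
proof (rule Ck_on_bootstrap)
  show "open (UNIV - {0 :: 'a})"
    by (simp add: open_delete)
  \<comment> \<open>The derivative of the norm is again expressed through the norm, as the bootstrap
    requires.\<close>
  show "(norm has_derivative (\<lambda>v. (v \<bullet> x) * inverse (norm x))) (at x)" if "x \<in> UNIV - {0}" for x :: 'a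
    using has_derivative_norm [of x] that
    by (simp add: sgn_div_norm inner_commute divide_inverse mult.commute)
  show "Ck_on j (\<lambda>x. (v \<bullet> x) * inverse (norm x)) (UNIV - {0})"
    if "Ck_on j norm (UNIV - {0 :: 'a})" for j and v :: 'a
    using that
    by (intro Ck_on_mult Ck_on_inverse Ck_on_linear [OF bounded_linear_inner_right]) (auto simp: open_delete)
qed

section \<open>Lipschitz functions\<close>

lemma lipschitz_on_mult:
  fixes f g :: "'a::metric_space \<Rightarrow> real"
  assumes f: "L-lipschitz_on X f" and g: "M-lipschitz_on X g"
    and bf: "\<And>x. x \<in> X \<Longrightarrow> \<bar>f x\<bar> \<le> B" and bg: "\<And>x. x \<in> X \<Longrightarrow> \<bar>g x\<bar> \<le> C" and "0 \<le> B" "0 \<le> C"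
  shows "(B * M + L * C)-lipschitz_on X (\<lambda>x. f x * g x)"
proof (rule lipschitz_onI)
  show "0 \<le> B * M + L * C"
    using lipschitz_on_nonneg [OF f] lipschitz_on_nonneg [OF g] assms(5,6) by simp
  fix x y assume "x \<in> X" "y \<in> X"
  have "\<bar>f x * g x - f y * g y\<bar> = \<bar>f x * (g x - g y) + (f x - f y) * g y\<bar>"
    by (simp add: algebra_simps)
  also have "\<dots> \<le> \<bar>f x\<bar> * \<bar>g x - g y\<bar> + \<bar>f x - f y\<bar> * \<bar>g y\<bar>"
    by (metis abs_mult abs_triangle_ineq)
  also have "\<dots> \<le> B * (M * dist x y) + (L * dist x y) * C"
    using lipschitz_onD [OF f \<open>x \<in> X\<close> \<open>y \<in> X\<close>] lipschitz_onD [OF g \<open>x \<in> X\<close> \<open>y \<in> X\<close>]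
      bf [OF \<open>x \<in> X\<close>] bg [OF \<open>y \<in> X\<close>] assms(5,6) lipschitz_on_nonneg [OF f]
    by (intro add_mono mult_mono) (auto simp: dist_real_def)
  finally show "dist (f x * g x) (f y * g y) \<le> (B * M + L * C) * dist x y"
    by (simp add: dist_real_def algebra_simps)
qed

text \<open>A Lipschitz function maps the exceptional null set to a null set, so if \<open>\<phi> b < \<phi> a\<close> some
  intermediate value is only taken at points where the derivative is positive; the last point
  taking this value gives a contradiction.\<close>

lemma lipschitz_AE_deriv_pos_imp_le:
  fixes \<phi> :: "real \<Rightarrow> real"
  assumes "a \<le> b" and lip: "L-lipschitz_on {a..b} \<phi>"
    and N: "negligible N"
    and der: "\<And>t. t \<in> {a..b} - N \<Longrightarrow> \<exists>d>0. (\<phi> has_real_derivative d) (at t within {a..b})"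
  shows "\<phi> a \<le> \<phi> b"
proof (rule ccontr)
  assume "\<not> \<phi> a \<le> \<phi> b"
  have "negligible (\<phi> ` (N \<inter> {a..b}))"
  proof (rule negligible_locally_Lipschitz_image)
    show "negligible (N \<inter> {a..b})"
      using N by (simp add: negligible_Int)
    show "\<exists>V B. open V \<and> x \<in> V \<and> (\<forall>y\<in>N \<inter> {a..b} \<inter> V. norm (\<phi> y - \<phi> x) \<le> B * norm (y - x))"
      if "x \<in> N \<inter> {a..b}" for x
      using that lipschitz_on_normD [OF lip] by (intro exI [of _ UNIV] exI [of _ L]) auto
  qed simp
  moreover have "\<not> negligible {\<phi> b<..<\<phi> a}"
    using \<open>\<not> \<phi> a \<le> \<phi> b\<close> open_not_negligible [of "{\<phi> b<..<\<phi> a}"] by auto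
  ultimately obtain y where y: "\<phi> b < y" "y < \<phi> a" and yN: "y \<notin> \<phi> ` (N \<inter> {a..b})"
    by (meson greaterThanLessThan_iff negligible_subset subsetI)
  \<comment> \<open>\<open>K\<close> is compact and has a last point \<open>c\<close>. By the
    intermediate value theorem \<open>\<phi> c = y\<close>, and the positive derivative there puts
    later points into \<open>K\<close>.\<close>
  define K where "K = {t \<in> {a..b}. \<phi> t \<ge> y}"
  have cont: "continuous_on {a..b} \<phi>"
    by (rule lipschitz_on_continuous_on [OF lip])
  have "K = {a..b} \<inter> \<phi> -` {y..}"
    by (auto simp: K_def)
  then have "compact K"
    using continuous_closed_preimage [OF cont closed_atLeastAtMost closed_atLeast]
    by (metis bounded_closed_interval bounded_subset compact_eq_bounded_closed inf_le1)
  moreover have "a \<in> K"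
    using y \<open>a \<le> b\<close> by (simp add: K_def)
  ultimately obtain c where c: "c \<in> K" "\<And>t. t \<in> K \<Longrightarrow> t \<le> c"
    using compact_attains_sup [of K] by blast
  then have cab: "c \<in> {a..b}" "y \<le> \<phi> c"
    by (auto simp: K_def)
  with y have "c < b"
    by (metis atLeastAtMost_iff less_le not_less)
  have "\<phi> c = y"
  proof (rule ccontr)
    assume "\<phi> c \<noteq> y"
    with cab y obtain t where "c \<le> t" "t \<le> b" "\<phi> t = y"
      using IVT2' [of \<phi> b y c] continuous_on_subset [OF cont, of "{c..b}"] \<open>c < b\<close> by fastforce
    moreover from this cab have "t \<in> K"
      by (simp add: K_def)
    ultimately show False
      using c(2) [of t] \<open>\<phi> c \<noteq> y\<close> by (metis antisym)
  qed
  with yN cab obtain d where "d > 0" and d: "(\<phi> has_real_derivative d) (at c within {a..b})"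
    using der [of c] by blast
  obtain e where "e > 0" and e: "\<And>h. 0 < h \<Longrightarrow> c + h \<in> {a..b} \<Longrightarrow> h < e \<Longrightarrow> \<phi> c < \<phi> (c + h)"
    using has_real_derivative_pos_inc_right [OF d \<open>d > 0\<close>] by blast
  define h where "h = min (e / 2) (b - c)"
  have "0 < h" "c + h \<in> {a..b}" "h < e"
    using \<open>e > 0\<close> \<open>c < b\<close> cab by (auto simp: h_def min_def)
  with e [of h] c(2) [of "c + h"] \<open>\<phi> c = y\<close> show False
    by (auto simp: K_def)
qed

text \<open>Adding \<open>e * t\<close> with \<open>e > 0\<close> makes the derivative strictly
  positive off a null set; then \<open>e\<close> tends to 0.\<close>

lemma lipschitz_AE_deriv_nonneg_imp_le:
  fixes \<phi> :: "real \<Rightarrow> real"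
  assumes "a \<le> b" and lip: "L-lipschitz_on {a..b} \<phi>"
    and AE: "AE t in lebesgue_on {a..b}. \<exists>d\<ge>0. (\<phi> has_real_derivative d) (at t within {a..b})"
  shows "\<phi> a \<le> \<phi> b"
proof -
  obtain N where "negligible N"
    and N: "\<And>t. t \<in> {a..b} - N \<Longrightarrow> \<exists>d\<ge>0. (\<phi> has_real_derivative d) (at t within {a..b})"
  proof -
    have "AE t in lebesgue. t \<in> {a..b} \<longrightarrow> (\<exists>d\<ge>0. (\<phi> has_real_derivative d) (at t within {a..b}))"
      using AE by (simp add: AE_restrict_space_iff)
    then show ?thesis
      by (elim AE_E3) (auto simp: negligible_iff_null_sets intro: that)
  qed
  have "\<phi> a + e * a \<le> \<phi> b + e * b" if "e > 0" for e
  proof (rule lipschitz_AE_deriv_pos_imp_le [OF \<open>a \<le> b\<close> _ \<open>negligible N\<close>])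
    show "(L + \<bar>e\<bar> * 1)-lipschitz_on {a..b} (\<lambda>t. \<phi> t + e * t)"
      by (intro lipschitz_on_add lip lipschitz_on_cmult_real lipschitz_on_id)
    show "\<exists>d>0. ((\<lambda>t. \<phi> t + e * t) has_real_derivative d) (at t within {a..b})"
      if t: "t \<in> {a..b} - N" for t
    proof -
      obtain d where "d \<ge> 0" "(\<phi> has_real_derivative d) (at t within {a..b})"
        using N t by blast
      then show ?thesis
        using \<open>e > 0\<close> by (intro exI [of _ "d + e"]) (auto intro!: derivative_eq_intros)
    qed
  qed
  then have "\<phi> a \<le> \<phi> b + e * (b - a)" if "e > 0" for e
    using that by (fastforce simp: algebra_simps)
  then have "\<phi> a \<le> \<phi> b + e" if "e > 0" for e
  proof (cases "a = b")
    case False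
    with \<open>a \<le> b\<close> that \<open>\<And>e. e > 0 \<Longrightarrow> \<phi> a \<le> \<phi> b + e * (b - a)\<close> [of "e / (b - a)"] show ?thesis
      by simp
  qed (use that in simp)
  then show ?thesis
    by (rule field_le_epsilon)
qed

text \<open>The continuous derivative is bounded on the compact interval, and the mean value
  inequality turns the bound into a Lipschitz constant.\<close>

lemma C1_imp_lipschitz_on_Icc:
  fixes f :: "real \<Rightarrow> 'a::real_normed_vector"
  assumes f: "\<And>t. t \<in> {a..b} \<Longrightarrow> (f has_vector_derivative f' t) (at t within {a..b})"
    and "continuous_on {a..b} f'"
  shows "\<exists>L. L-lipschitz_on {a..b} f"
proof -
  have "bounded (f' ` {a..b})"
    by (intro compact_imp_bounded compact_continuous_image assms) auto
  then obtain B where "B > 0" and B: "\<And>t. t \<in> {a..b} \<Longrightarrow> norm (f' t) \<le> B"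
    by (auto simp: bounded_pos)
  have onorm: "onorm (\<lambda>h. h *\<^sub>R f' t) \<le> B" if "t \<in> {a..b}" for t
    by (rule onorm_le) (use B [OF that] in \<open>simp add: mult.commute [of B] mult_left_mono\<close>)
  have "norm (f x - f y) \<le> B * norm (x - y)" if "x \<in> {a..b}" "y \<in> {a..b}" for x y
    using that
    by (intro differentiable_bound [where S = "{a..b}" and f' = "\<lambda>t h. h *\<^sub>R f' t"])
      (auto intro!: f [unfolded has_vector_derivative_def] onorm)
  then show ?thesis
    using \<open>B > 0\<close> by (auto intro!: exI [of _ B] lipschitz_onI simp: dist_norm)
qed

lemma lipschitz_on_compact_mult:
  fixes f g :: "'a::metric_space \<Rightarrow> real"
  assumes "compact X" "\<exists>L. L-lipschitz_on X f" "\<exists>M. M-lipschitz_on X g"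
  shows "\<exists>N. N-lipschitz_on X (\<lambda>x. f x * g x)"
proof -
  obtain L M where L: "L-lipschitz_on X f" and M: "M-lipschitz_on X g"
    using assms by blast
  have "bounded (f ` X)" "bounded (g ` X)"
    using lipschitz_on_continuous_on [OF L] lipschitz_on_continuous_on [OF M] \<open>compact X\<close>
    by (auto intro: compact_imp_bounded compact_continuous_image)
  then obtain B C where "B > 0" "C > 0"
    and "\<And>x. x \<in> X \<Longrightarrow> \<bar>f x\<bar> \<le> B" "\<And>x. x \<in> X \<Longrightarrow> \<bar>g x\<bar> \<le> C"
    by (auto simp: bounded_pos)
  then show ?thesis
    using lipschitz_on_mult [OF L M, of B C] by auto
qed

lemma lipschitz_on_vec_nth:
  fixes f :: "'a::metric_space \<Rightarrow> real^'n"
  assumes "L-lipschitz_on X f"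
  shows "L-lipschitz_on X (\<lambda>x. f x $ i)"
proof (rule lipschitz_onI)
  fix x y assume "x \<in> X" "y \<in> X"
  then show "dist (f x $ i) (f y $ i) \<le> L * dist x y"
    using lipschitz_onD [OF assms] dist_vec_nth_le order_trans by blast
qed (rule lipschitz_on_nonneg [OF assms])

section \<open>The extremal height\<close>

text \<open>The right-hand side has derivative \<open>u * cos u \<ge> 0\<close>. With
  \<open>u = T / r\<close> it is the derivative in \<open>r\<close> of the exit radius
  \<open>r * cos (T / r)\<close>.\<close>

lemma cos_plus_mult_sin_ge_1:
  fixes u :: real
  assumes "0 \<le> u" "u \<le> pi / 2"
  shows "1 \<le> cos u + u * sin u"
proof -
  have "cos 0 + 0 * sin 0 \<le> cos u + u * sin u"
  proof (rule DERIV_nonneg_imp_nondecreasing [OF \<open>0 \<le> u\<close>])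
    fix x assume "0 \<le> x" "x \<le> u"
    have "((\<lambda>x. cos x + x * sin x) has_real_derivative x * cos x) (at x)"
      by (auto intro!: derivative_eq_intros)
    then show "\<exists>y. ((\<lambda>x. cos x + x * sin x) has_real_derivative y) (at x) \<and> 0 \<le> y"
      using \<open>0 \<le> x\<close> \<open>x \<le> u\<close> assms by (intro exI [of _ "x * cos x"]) (simp add: cos_ge_zero)
  qed
  then show ?thesis
    by simp
qed

text \<open>\<open>T / r\<close> is half the central angle of an arc of length \<open>T\<close> on a
  circle of diameter \<open>r\<close>. At \<open>r = 2 * T / pi\<close> the arc is a half
  circle.\<close>

lemma launch_angle_bounds:
  fixes T r :: real
  assumes "T > 0" "2 * T / pi \<le> r"
  shows "0 < r" "0 < T / r" "T / r \<le> pi / 2"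
proof -
  show "0 < r"
    using assms by (smt (verit) divide_pos_pos pi_gt_zero)
  then show "0 < T / r" "T / r \<le> pi / 2"
    using assms by (simp_all add: field_simps)
qed

lemma exit_radius_deriv:
  fixes T r :: real
  assumes "r \<noteq> 0"
  shows "((\<lambda>r. r * cos (T / r)) has_real_derivative cos (T / r) + T / r * sin (T / r)) (at r)"
  using assms by (auto intro!: derivative_eq_intros simp: field_simps power2_eq_square)

text \<open>The exit radius has derivative at least 1, so subtracting \<open>r\<close> leaves a
  nondecreasing function. Injectivity, unboundedness and a 1-Lipschitz inverse all follow.\<close>

lemma exit_radius_expanding:
  fixes T r s :: real
  assumes "T > 0" "2 * T / pi \<le> r" "r \<le> s"
  shows "s - r \<le> s * cos (T / s) - r * cos (T / r)"
proof -
  have "r * cos (T / r) - r \<le> s * cos (T / s) - s"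
  proof (rule DERIV_nonneg_imp_nondecreasing [OF \<open>r \<le> s\<close>])
    fix x assume "r \<le> x" "x \<le> s"
    with assms have x: "2 * T / pi \<le> x"
      by simp
    note b = launch_angle_bounds [OF \<open>T > 0\<close> x]
    have "((\<lambda>x. x * cos (T / x) - x) has_real_derivative cos (T / x) + T / x * sin (T / x) - 1) (at x)"
      using b by (intro DERIV_diff exit_radius_deriv DERIV_ident) auto
    moreover have "0 \<le> cos (T / x) + T / x * sin (T / x) - 1"
      using cos_plus_mult_sin_ge_1 [of "T / x"] b by simp
    ultimately show "\<exists>y. ((\<lambda>x. x * cos (T / x) - x) has_real_derivative y) (at x) \<and> 0 \<le> y"
      by blast
  qed
  then show ?thesis
    by simp
qed

lemma exit_radius_exists:
  fixes T \<rho> :: real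
  assumes "T > 0" "\<rho> \<ge> 0"
  shows "\<exists>r \<ge> 2 * T / pi. r * cos (T / r) = \<rho>"
proof -
  let ?r0 = "2 * T / pi"
  have r0: "?r0 * cos (T / ?r0) = 0"
    using assms by simp
  have "continuous_on {?r0..?r0 + \<rho>} (\<lambda>r. r * cos (T / r))"
    using launch_angle_bounds(1) [OF \<open>T > 0\<close>]
    by (intro continuous_intros) force
  \<comment> \<open>The exit radius is 0 at \<open>?r0\<close> and expanding, so it has reached
    \<open>\<rho>\<close> by \<open>?r0 + \<rho>\<close>.\<close>
  moreover have "\<rho> \<le> (?r0 + \<rho>) * cos (T / (?r0 + \<rho>))"
    using exit_radius_expanding [of T ?r0 "?r0 + \<rho>"] assms r0 by simp
  ultimately show ?thesis
    using IVT' [of "\<lambda>r. r * cos (T / r)" ?r0 \<rho> "?r0 + \<rho>"] r0 assms by force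
qed

text \<open>The extremal of length \<open>T\<close> that starts at distance \<open>r\<close> from the axis is an arc of a circle
  of radius \<open>r / 2\<close> through the origin, tangent at its start to the circle of radius \<open>r\<close>; it ends
  at distance \<open>r * cos (T / r)\<close>.\<close>

definition launch_radius :: "real \<Rightarrow> real \<Rightarrow> real" where
  "launch_radius T \<rho> = (THE r. 2 * T / pi \<le> r \<and> r * cos (T / r) = \<rho>)"

lemma launch_radius_unique:
  assumes "T > 0" "2 * T / pi \<le> r"
  shows "launch_radius T (r * cos (T / r)) = r"
  unfolding launch_radius_def
proof (rule the_equality)
  fix s assume s: "2 * T / pi \<le> s \<and> s * cos (T / s) = r * cos (T / r)"
  then show "s = r"
    using exit_radius_expanding [of T r s] exit_radius_expanding [of T s r] assms by linarith
qed (use assms in auto)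

lemma launch_radius:
  assumes "T > 0" "\<rho> \<ge> 0"
  shows launch_radius_ge: "2 * T / pi \<le> launch_radius T \<rho>"
    and exit_launch_radius: "launch_radius T \<rho> * cos (T / launch_radius T \<rho>) = \<rho>"
proof -
  obtain r where "2 * T / pi \<le> r" "r * cos (T / r) = \<rho>"
    using exit_radius_exists [OF assms] by blast
  with launch_radius_unique [OF \<open>T > 0\<close>, of r]
  show "2 * T / pi \<le> launch_radius T \<rho>"
    and "launch_radius T \<rho> * cos (T / launch_radius T \<rho>) = \<rho>"
    by auto
qed

lemma launch_radius_0:
  assumes "T > 0"
  shows "launch_radius T 0 = 2 * T / pi"
  using launch_radius_unique [OF assms, of "2 * T / pi"] assms by simp

lemma launch_radius_gt:
  assumes "T > 0" "\<rho> > 0"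
  shows "2 * T / pi < launch_radius T \<rho>"
proof -
  have "launch_radius T \<rho> \<noteq> 2 * T / pi"
    using exit_launch_radius [OF \<open>T > 0\<close>, of \<rho>] assms by auto
  then show ?thesis
    using launch_radius_ge [OF \<open>T > 0\<close>, of \<rho>] assms by simp
qed

lemma launch_radius_lipschitz:
  assumes "T > 0"
  shows "1-lipschitz_on {0..} (launch_radius T)"
proof (rule lipschitz_onI)
  fix x y :: real assume "x \<in> {0..}" "y \<in> {0..}"
  then have xy: "0 \<le> x" "0 \<le> y"
    by auto
  show "dist (launch_radius T x) (launch_radius T y) \<le> 1 * dist x y"
    using exit_radius_expanding [of T "launch_radius T x" "launch_radius T y"]
      exit_radius_expanding [of T "launch_radius T y" "launch_radius T x"]
      launch_radius [OF assms xy(1)] launch_radius [OF assms xy(2)] assms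
    by (simp add: dist_real_def) linarith
qed simp

lemma launch_radius_deriv:
  assumes "T > 0" "\<rho> > 0"
  shows "(launch_radius T has_real_derivative
    inverse (cos (T / launch_radius T \<rho>) + T / launch_radius T \<rho> * sin (T / launch_radius T \<rho>))) (at \<rho>)"
\<comment> \<open>The window from 0 to \<open>\<rho> + 1\<close> contains \<open>\<rho>\<close> and
  stays among the nonnegative radii, where \<open>launch_radius\<close> inverts the exit
  radius.\<close>
proof (rule DERIV_inverse_function [where a = 0 and b = "\<rho> + 1"])
  let ?r = "launch_radius T \<rho>"
  have r: "2 * T / pi \<le> ?r"
    using launch_radius_ge assms by simp
  note b = launch_angle_bounds [OF \<open>T > 0\<close> r]
  show "((\<lambda>r. r * cos (T / r)) has_real_derivative cos (T / ?r) + T / ?r * sin (T / ?r)) (at ?r)"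
    using b by (intro exit_radius_deriv) auto
  show "cos (T / ?r) + T / ?r * sin (T / ?r) \<noteq> 0"
    using cos_plus_mult_sin_ge_1 [of "T / ?r"] b by linarith
  have "continuous_on {0..} (launch_radius T)"
    by (rule lipschitz_on_continuous_on [OF launch_radius_lipschitz [OF \<open>T > 0\<close>]])
  then show "isCont (launch_radius T) \<rho>"
    using assms by (intro continuous_on_interior [of "{0..}"]) auto
qed (use assms exit_launch_radius in auto)

text \<open>The area swept by the extremal arc ending at distance \<open>\<rho>\<close> from the axis.\<close>

definition height :: "real \<Rightarrow> real \<Rightarrow> real" where
  "height T \<rho> = launch_radius T \<rho> * T / 4 + launch_radius T \<rho> * \<rho> * sin (T / launch_radius T \<rho>) / 4"

lemma height_pos:
  assumes "T > 0" "\<rho> \<ge> 0"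
  shows "height T \<rho> > 0"
proof -
  note b = launch_angle_bounds [OF \<open>T > 0\<close> launch_radius_ge [OF assms]]
  have "sin (T / launch_radius T \<rho>) > 0"
    using b pi_gt_zero by (intro sin_gt_zero) linarith+
  with b assms show ?thesis
    by (simp add: height_def add_pos_nonneg)
qed

text \<open>The origin is included, since \<open>launch_radius T\<close> is Lipschitz on all of
  \<open>{0..}\<close>.\<close>

lemma continuous_on_height_norm:
  fixes X :: "'a::real_normed_vector set"
  assumes "T > 0"
  shows "continuous_on X (\<lambda>p. height T (norm p))"
proof -
  have "launch_radius T (norm p) \<noteq> 0" for p :: 'a
    using launch_angle_bounds(1) [OF \<open>T > 0\<close> launch_radius_ge [OF assms norm_ge_zero]]
    by (metis less_irrefl)
  moreover have "continuous_on X (\<lambda>p. launch_radius T (norm p))"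
    by (rule continuous_on_compose2 [OF lipschitz_on_continuous_on [OF launch_radius_lipschitz [OF assms]]])
      (auto intro: continuous_intros)
  ultimately show ?thesis
    unfolding height_def by (intro continuous_intros) auto
qed

lemma smooth_on_height_norm:
  assumes "T > 0"
  shows "smooth_on (\<lambda>p :: 'a::euclidean_space. height T (norm p)) (UNIV - {0})"
  unfolding smooth_on_def
proof
  fix k
  let ?U = "UNIV - {0 :: 'a}" and ?R = "\<lambda>p :: 'a. launch_radius T (norm p)"
  \<comment> \<open>\<open>?Q p\<close> is the derivative of the exit radius at \<open>?R p\<close>.
    Quotients are written with \<open>inverse\<close> to match the \<open>Ck_on\<close>
    rules.\<close>
  let ?Q = "\<lambda>p. cos (T * inverse (?R p)) + T * inverse (?R p) * sin (T * inverse (?R p))"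
  have U: "open ?U"
    by (simp add: open_delete)
  have b: "0 < ?R p" "0 < T / ?R p" "T / ?R p \<le> pi / 2" for p
    using launch_angle_bounds [OF \<open>T > 0\<close> launch_radius_ge [OF assms norm_ge_zero]] by auto
  have R0: "?R p \<noteq> 0" for p
    using b(1) [of p] by simp
  have Q0: "?Q p \<noteq> 0" for p
    using cos_plus_mult_sin_ge_1 [of "T / ?R p"] b [of p] unfolding divide_inverse by linarith
  \<comment> \<open>The derivative of \<open>?R\<close> is an expression in \<open>?R\<close> and
    the norm that preserves \<open>Ck_on\<close>, so the bootstrap gives all orders.\<close>
  have R: "Ck_on k ?R ?U" for k
  proof (rule Ck_on_bootstrap [OF U])
    show "(?R has_derivative (\<lambda>v. (v \<bullet> x) * inverse (norm x) * inverse (?Q x))) (at x)"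
      if "x \<in> ?U" for x
    proof -
      have "(norm has_derivative (\<lambda>v. (v \<bullet> x) * inverse (norm x))) (at x)"
        using has_derivative_norm [of x] that
        by (simp add: sgn_div_norm inner_commute divide_inverse mult.commute)
      from DERIV_compose_FDERIV [where g = norm and x = x, OF launch_radius_deriv [OF \<open>T > 0\<close>] this]
      show ?thesis
        using that unfolding divide_inverse by simp
    qed
    show "Ck_on j (\<lambda>x. (v \<bullet> x) * inverse (norm x) * inverse (?Q x)) ?U" if "Ck_on j ?R ?U" for j v
      using that R0 Q0
      by (intro Ck_on_mult Ck_on_inverse Ck_on_add Ck_on_sin Ck_on_cos Ck_on_const Ck_on_norm U
          Ck_on_linear [OF bounded_linear_inner_right]) auto
  qed
  have "Ck_on k (\<lambda>p. ?R p * T * inverse 4 + ?R p * norm p * sin (T * inverse (?R p)) * inverse 4) ?U"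
    by (intro Ck_on_mult Ck_on_inverse Ck_on_add Ck_on_sin Ck_on_const Ck_on_norm U R R0)
  then show "Ck_on k (\<lambda>p. height T (norm p)) ?U"
    by (simp only: height_def divide_inverse)
qed

section \<open>The flow of the maximised Hamiltonian\<close>

lemma vector3_eq_axis:
  "(vector [a, b, c] :: real^3) = a *\<^sub>R axis 1 1 + b *\<^sub>R axis 2 1 + c *\<^sub>R axis 3 1"
  by (simp add: vec_eq_iff forall_3 axis_def)

lemma vector3_collapse: "vector [q $ 1, q $ 2, q $ 3] = (q :: real^3)"
  by (simp add: vec_eq_iff forall_3)

lemma has_vector_derivative_vector3:
  assumes "(f has_real_derivative f') F" "(g has_real_derivative g') F" "(h has_real_derivative h') F"
  shows "((\<lambda>t. vector [f t, g t, h t] :: real^3) has_vector_derivative vector [f', g', h']) F"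
  using assms unfolding vector3_eq_axis has_real_derivative_iff_has_vector_derivative
  by (intro has_vector_derivative_add bounded_linear.has_vector_derivative [OF bounded_linear_scaleR_left])

lemma blinfun_apply_real3:
  fixes l :: "(real^3) \<Rightarrow>\<^sub>L real"
  shows "blinfun_apply l v = blinfun_apply l (axis 1 1) * v $ 1 + blinfun_apply l (axis 2 1) * v $ 2
    + blinfun_apply l (axis 3 1) * v $ 3"
  by (subst vector3_collapse [of v, symmetric], subst vector3_eq_axis)
    (simp add: blinfun.add_right blinfun.scaleR_right)

lemma eq_of_has_real_derivative_eq:
  fixes f g :: "real \<Rightarrow> real"
  assumes "convex S" "a \<in> S" "f a = g a" "t \<in> S"
    and "\<And>t. t \<in> S \<Longrightarrow> (f has_real_derivative d t) (at t within S)"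
    and "\<And>t. t \<in> S \<Longrightarrow> (g has_real_derivative d t) (at t within S)"
  shows "f t = g t"
proof -
  have "((\<lambda>t. f t - g t) has_real_derivative 0) (at t within S)" if "t \<in> S" for t
    using DERIV_diff [OF assms(5,6) [OF that]] by simp
  then obtain c where "\<And>t. t \<in> S \<Longrightarrow> f t - g t = c"
    using has_field_derivative_zero_constant [OF \<open>convex S\<close>] by metis
  with assms show ?thesis
    by (metis eq_iff_diff_eq_0)
qed

text \<open>A covector at \<open>q\<close> is \<open>a \<alpha> + b dx + c dy\<close> with \<open>a = cov_a\<close>, \<open>b = cov_b\<close> and \<open>c = cov_c\<close>.\<close>

definition cov_a :: "cotangent \<Rightarrow> real" where
  "cov_a w = blinfun_apply (snd w) (axis 3 1)"

definition cov_b :: "cotangent \<Rightarrow> real" where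
  "cov_b w = blinfun_apply (snd w) (axis 1 1) - cov_a w * fst w $ 2 / 2"

definition cov_c :: "cotangent \<Rightarrow> real" where
  "cov_c w = blinfun_apply (snd w) (axis 2 1) + cov_a w * fst w $ 1 / 2"

lemma max_hamiltonian_cov: "max_hamiltonian w = sqrt ((cov_b w)\<^sup>2 + (cov_c w)\<^sup>2)"
proof -
  have "max_hamiltonian (fst w, snd w) = sqrt ((cov_b w)\<^sup>2 + (cov_c w)\<^sup>2)"
    by (rule max_hamiltonian_eq [where a = "cov_a w"], subst blinfun_apply_real3)
      (simp add: cov_a_def cov_b_def cov_c_def contact_form_def algebra_simps)
  then show ?thesis
    by simp
qed

lemma max_hamiltonian_eq_1_iff: "max_hamiltonian w = 1 \<longleftrightarrow> (cov_b w)\<^sup>2 + (cov_c w)\<^sup>2 = 1"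
  by (simp add: max_hamiltonian_cov)

lemma has_derivative_cov:
  shows "(cov_a has_derivative cov_a) F"
    and "(cov_b has_derivative (\<lambda>X. blinfun_apply (snd X) (axis 1 1)
      - (cov_a X * fst w $ 2 + cov_a w * fst X $ 2) / 2)) (at w within S)"
    and "(cov_c has_derivative (\<lambda>X. blinfun_apply (snd X) (axis 2 1)
      + (cov_a X * fst w $ 1 + cov_a w * fst X $ 1) / 2)) (at w within S)"
proof -
  have lin: "bounded_linear (\<lambda>w :: cotangent. blinfun_apply (snd w) v)"
    "bounded_linear (\<lambda>w :: cotangent. fst w $ i)" for v i
    by (rule bounded_linear_compose [OF blinfun.bounded_linear_left bounded_linear_snd],
        rule bounded_linear_compose [OF bounded_linear_vec_nth bounded_linear_fst])
  note lin' = lin [THEN bounded_linear_imp_has_derivative]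
  show a: "(cov_a has_derivative cov_a) F" for F
    unfolding cov_a_def by (rule lin')
  show "(cov_b has_derivative (\<lambda>X. blinfun_apply (snd X) (axis 1 1)
      - (cov_a X * fst w $ 2 + cov_a w * fst X $ 2) / 2)) (at w within S)"
    unfolding cov_b_def
    by (rule derivative_eq_intros a lin' refl | simp add: algebra_simps)+
  show "(cov_c has_derivative (\<lambda>X. blinfun_apply (snd X) (axis 2 1)
      + (cov_a X * fst w $ 1 + cov_a w * fst X $ 1) / 2)) (at w within S)"
    unfolding cov_c_def
    by (rule derivative_eq_intros a lin' refl | simp add: algebra_simps)+
qed

text \<open>The Hamiltonian vector field of \<open>(b^2 + c^2) / 2\<close>, which on the unit level
  set agrees with that of \<open>sqrt (b^2 + c^2)\<close>.\<close>

definition hamiltonian_field :: "cotangent \<Rightarrow> cotangent" where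
  "hamiltonian_field w =
    (vector [cov_b w, cov_c w, (fst w $ 1 * cov_c w - fst w $ 2 * cov_b w) / 2],
     blinfun_inner_right (vector [- (cov_a w * cov_c w / 2), cov_a w * cov_b w / 2, 0]))"

text \<open>The pairing is nondegenerate: \<open>\<mu> = 0\<close> recovers the covector part, and
  pairing with the difference of the vector parts shows that this difference vanishes.\<close>

lemma is_hamiltonian_vector_unique:
  assumes "is_hamiltonian_vector h w X" "is_hamiltonian_vector h w Y"
  shows "X = Y"
proof -
  have "(\<lambda>(v, \<mu>). blinfun_apply \<mu> (fst X) - blinfun_apply (snd X) v)
      = (\<lambda>(v, \<mu>). blinfun_apply \<mu> (fst Y) - blinfun_apply (snd Y) v)"
    using assms unfolding is_hamiltonian_vector_def by (rule has_derivative_unique)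
  then have eq: "blinfun_apply \<mu> (fst X) - blinfun_apply (snd X) v
      = blinfun_apply \<mu> (fst Y) - blinfun_apply (snd Y) v" for v \<mu>
    by (metis case_prod_conv)
  have "snd X = snd Y"
    using eq [of 0] by (intro blinfun_eqI) simp
  moreover have "(fst X - fst Y) \<bullet> (fst X - fst Y) = 0"
    using eq [of "blinfun_inner_right (fst X - fst Y)" 0] by (simp add: inner_diff_right blinfun.zero_right)
  ultimately show ?thesis
    by (simp add: prod_eq_iff)
qed

lemma is_hamiltonian_vector_max_hamiltonian_iff:
  assumes "max_hamiltonian w = 1"
  shows "is_hamiltonian_vector max_hamiltonian w X \<longleftrightarrow> X = hamiltonian_field w"
proof -
  have sq: "(cov_b w)\<^sup>2 + (cov_c w)\<^sup>2 = 1"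
    using assms by (simp add: max_hamiltonian_eq_1_iff)
  \<comment> \<open>The chain rule brings in the factor \<open>1 / sqrt (b^2 + c^2)\<close>, which
    is 1 on the level set.\<close>
  have "((\<lambda>w. sqrt ((cov_b w)\<^sup>2 + (cov_c w)\<^sup>2)) has_derivative
    (\<lambda>X. cov_b w * (blinfun_apply (snd X) (axis 1 1) - (cov_a X * fst w $ 2 + cov_a w * fst X $ 2) / 2)
      + cov_c w * (blinfun_apply (snd X) (axis 2 1) + (cov_a X * fst w $ 1 + cov_a w * fst X $ 1) / 2))) (at w)"
    by (rule derivative_eq_intros has_derivative_cov refl | simp add: sq fun_eq_iff field_simps)+
  also have "(\<lambda>X. cov_b w * (blinfun_apply (snd X) (axis 1 1) - (cov_a X * fst w $ 2 + cov_a w * fst X $ 2) / 2)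
      + cov_c w * (blinfun_apply (snd X) (axis 2 1) + (cov_a X * fst w $ 1 + cov_a w * fst X $ 1) / 2))
    = (\<lambda>(v, \<mu>). blinfun_apply \<mu> (fst (hamiltonian_field w)) - blinfun_apply (snd (hamiltonian_field w)) v)"
  proof (intro ext, clarify)
    fix v \<mu>
    show "cov_b w * (blinfun_apply (snd (v, \<mu>)) (axis 1 1)
          - (cov_a (v, \<mu>) * fst w $ 2 + cov_a w * fst (v, \<mu>) $ 2) / 2)
        + cov_c w * (blinfun_apply (snd (v, \<mu>)) (axis 2 1)
          + (cov_a (v, \<mu>) * fst w $ 1 + cov_a w * fst (v, \<mu>) $ 1) / 2)
      = blinfun_apply \<mu> (fst (hamiltonian_field w)) - blinfun_apply (snd (hamiltonian_field w)) v"
      by (subst blinfun_apply_real3 [of \<mu> "fst (hamiltonian_field w)"])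
        (simp add: hamiltonian_field_def cov_a_def [of "(v, \<mu>)"] inner_vec_def sum_3 field_simps)
  qed
  finally have "is_hamiltonian_vector max_hamiltonian w (hamiltonian_field w)"
    by (simp add: is_hamiltonian_vector_def flip: max_hamiltonian_cov)
  then show ?thesis
    using is_hamiltonian_vector_unique by blast
qed

text \<open>The differential of \<open>h\<close> on its own Hamiltonian vector
  \<open>(u, \<nu>)\<close> is \<open>\<nu> u - \<nu> u = 0\<close>.\<close>

lemma hamiltonian_curve_conserves:
  assumes "hamiltonian_curve h T \<eta>" "t \<in> {0..T}"
  shows "h (\<eta> t) = h (\<eta> 0)"
proof (rule eq_of_has_real_derivative_eq [of "{0..T}" 0 "\<lambda>t. h (\<eta> t)" "\<lambda>_. h (\<eta> 0)" t "\<lambda>_. 0"])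
  fix s assume "s \<in> {0..T}"
  then obtain X where X: "is_hamiltonian_vector h (\<eta> s) X"
    and \<eta>: "(\<eta> has_vector_derivative X) (at s within {0..T})"
    using assms(1) unfolding hamiltonian_curve_def by blast
  from has_derivative_compose [OF \<eta> [unfolded has_vector_derivative_def]
      X [unfolded is_hamiltonian_vector_def]]
  show "((\<lambda>t. h (\<eta> t)) has_real_derivative 0) (at s within {0..T})"
    by (simp add: has_field_derivative_def case_prod_beta blinfun.scaleR_left blinfun.scaleR_right lambda_zero)
qed (use assms in auto)

lemma hamiltonian_curve_max_hamiltonian_iff:
  assumes "max_hamiltonian (\<eta> 0) = 1"
  shows "hamiltonian_curve max_hamiltonian T \<eta> \<longleftrightarrow>
    (\<forall>t\<in>{0..T}. max_hamiltonian (\<eta> t) = 1 \<and>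
      (\<eta> has_vector_derivative hamiltonian_field (\<eta> t)) (at t within {0..T}))"
    (is "_ \<longleftrightarrow> ?R")
proof
  assume c: "hamiltonian_curve max_hamiltonian T \<eta>"
  show ?R
    using hamiltonian_curve_conserves [OF c] c assms
    by (auto simp: hamiltonian_curve_def is_hamiltonian_vector_max_hamiltonian_iff)
next
  assume ?R
  then show "hamiltonian_curve max_hamiltonian T \<eta>"
    by (auto simp: hamiltonian_curve_def is_hamiltonian_vector_max_hamiltonian_iff)
qed

text \<open>The rotation of \<open>(b, c)\<close> with speed \<open>a\<close> has two equal sources:
  the change of the covector, and the motion of the base point, which enters through
  \<open>cov_b\<close> and \<open>cov_c\<close>.\<close>

lemma max_hamiltonian_curve_components:
  assumes "hamiltonian_curve max_hamiltonian T \<eta>" "max_hamiltonian (\<eta> 0) = 1" "t \<in> {0..T}"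
  shows "((\<lambda>t. cov_a (\<eta> t)) has_real_derivative 0) (at t within {0..T})"
    and "((\<lambda>t. cov_b (\<eta> t)) has_real_derivative - (cov_a (\<eta> t) * cov_c (\<eta> t))) (at t within {0..T})"
    and "((\<lambda>t. cov_c (\<eta> t)) has_real_derivative cov_a (\<eta> t) * cov_b (\<eta> t)) (at t within {0..T})"
    and "((\<lambda>t. fst (\<eta> t) $ 1) has_real_derivative cov_b (\<eta> t)) (at t within {0..T})"
    and "((\<lambda>t. fst (\<eta> t) $ 2) has_real_derivative cov_c (\<eta> t)) (at t within {0..T})"
    and "((\<lambda>t. fst (\<eta> t) $ 3) has_real_derivative
      (fst (\<eta> t) $ 1 * cov_c (\<eta> t) - fst (\<eta> t) $ 2 * cov_b (\<eta> t)) / 2) (at t within {0..T})"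
proof -
  have \<eta>: "(\<eta> has_derivative (\<lambda>s. s *\<^sub>R hamiltonian_field (\<eta> t))) (at t within {0..T})"
    using assms hamiltonian_curve_max_hamiltonian_iff by (auto simp: has_vector_derivative_def)
  have cov: "cov_a (s *\<^sub>R hamiltonian_field w) = 0"
    "blinfun_apply (snd (s *\<^sub>R hamiltonian_field w)) (axis 1 1) = s * (- (cov_a w * cov_c w / 2))"
    "blinfun_apply (snd (s *\<^sub>R hamiltonian_field w)) (axis 2 1) = s * (cov_a w * cov_b w / 2)"
    "fst (s *\<^sub>R hamiltonian_field w) $ 1 = s * cov_b w"
    "fst (s *\<^sub>R hamiltonian_field w) $ 2 = s * cov_c w"
    "fst (s *\<^sub>R hamiltonian_field w) $ 3 = s * ((fst w $ 1 * cov_c w - fst w $ 2 * cov_b w) / 2)"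
    for s w
    by (simp_all add: cov_a_def hamiltonian_field_def blinfun.scaleR_left inner_axis)
  show "((\<lambda>t. cov_a (\<eta> t)) has_real_derivative 0) (at t within {0..T})"
    using has_derivative_compose [OF \<eta> has_derivative_cov(1)]
    by (simp add: has_field_derivative_def cov lambda_zero)
  show "((\<lambda>t. cov_b (\<eta> t)) has_real_derivative - (cov_a (\<eta> t) * cov_c (\<eta> t))) (at t within {0..T})"
    using has_derivative_compose [OF \<eta> has_derivative_cov(2)] unfolding has_field_derivative_def cov
    by (rule has_derivative_eq_rhs) (simp add: fun_eq_iff field_simps)
  show "((\<lambda>t. cov_c (\<eta> t)) has_real_derivative cov_a (\<eta> t) * cov_b (\<eta> t)) (at t within {0..T})"
    using has_derivative_compose [OF \<eta> has_derivative_cov(3)] unfolding has_field_derivative_def cov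
    by (rule has_derivative_eq_rhs) (simp add: fun_eq_iff field_simps)
  have fst: "((\<lambda>t. fst (\<eta> t) $ i) has_real_derivative D) (at t within {0..T})"
    if "\<And>s. fst (s *\<^sub>R hamiltonian_field (\<eta> t)) $ i = s * D" for i D
  proof -
    have "((\<lambda>t. fst (\<eta> t) $ i) has_derivative (\<lambda>s. fst (s *\<^sub>R hamiltonian_field (\<eta> t)) $ i))
        (at t within {0..T})"
      by (intro bounded_linear.has_derivative [OF bounded_linear_vec_nth] has_derivative_fst \<eta>)
    then show ?thesis
      by (simp add: that has_field_derivative_def mult_commute_abs del: fst_scaleR)
  qed
  show "((\<lambda>t. fst (\<eta> t) $ 1) has_real_derivative cov_b (\<eta> t)) (at t within {0..T})"
    and "((\<lambda>t. fst (\<eta> t) $ 2) has_real_derivative cov_c (\<eta> t)) (at t within {0..T})"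
    and "((\<lambda>t. fst (\<eta> t) $ 3) has_real_derivative
      (fst (\<eta> t) $ 1 * cov_c (\<eta> t) - fst (\<eta> t) $ 2 * cov_b (\<eta> t)) / 2) (at t within {0..T})"
    by (rule fst cov)+
qed

text \<open>Along an integral curve \<open>a\<close> is constant and \<open>(b, c)\<close> rotates with angular speed \<open>a\<close>, so
  the distance between the \<open>(b, c)\<close>-parts of two integral curves with equal \<open>a\<close> is constant.\<close>

lemma max_hamiltonian_curve_unique:
  assumes "0 \<le> T" and 1: "hamiltonian_curve max_hamiltonian T \<eta>" "max_hamiltonian (\<eta> 0) = 1"
    and 2: "hamiltonian_curve max_hamiltonian T \<zeta>" "\<zeta> 0 = \<eta> 0"
  shows "\<zeta> T = \<eta> T"
proof -
  note d1 = max_hamiltonian_curve_components [OF 1]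
  note d2 = max_hamiltonian_curve_components [OF 2(1), unfolded 2(2), OF 1(2)]
  have 0: "convex {0..T}" "0 \<in> {0..T}"
    using \<open>0 \<le> T\<close> by auto
  note eqI = eq_of_has_real_derivative_eq [OF 0]
  have a: "cov_a (\<zeta> t) = cov_a (\<eta> t)" if "t \<in> {0..T}" for t
    by (rule eqI [OF _ that d2(1) d1(1)]) (simp add: 2(2))
  have "(cov_b (\<zeta> t) - cov_b (\<eta> t))\<^sup>2 + (cov_c (\<zeta> t) - cov_c (\<eta> t))\<^sup>2 = 0" if "t \<in> {0..T}" for t
  proof (rule eqI [OF _ that _ DERIV_const])
    fix s assume s: "s \<in> {0..T}"
    have "((\<lambda>t. (cov_b (\<zeta> t) - cov_b (\<eta> t))\<^sup>2 + (cov_c (\<zeta> t) - cov_c (\<eta> t))\<^sup>2) has_real_derivative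
        2 * (cov_b (\<zeta> s) - cov_b (\<eta> s)) * (- (cov_a (\<zeta> s) * cov_c (\<zeta> s)) + cov_a (\<eta> s) * cov_c (\<eta> s))
        + 2 * (cov_c (\<zeta> s) - cov_c (\<eta> s)) * (cov_a (\<zeta> s) * cov_b (\<zeta> s) - cov_a (\<eta> s) * cov_b (\<eta> s)))
        (at s within {0..T})"
      by (rule derivative_eq_intros d1 [OF s] d2 [OF s] refl)+ (simp add: algebra_simps)
    then show "((\<lambda>t. (cov_b (\<zeta> t) - cov_b (\<eta> t))\<^sup>2 + (cov_c (\<zeta> t) - cov_c (\<eta> t))\<^sup>2)
        has_real_derivative 0) (at s within {0..T})"
      by (rule DERIV_cong) (simp add: a [OF s] algebra_simps)
  qed (simp add: 2(2))
  then have bc: "cov_b (\<zeta> t) = cov_b (\<eta> t)" "cov_c (\<zeta> t) = cov_c (\<eta> t)" if "t \<in> {0..T}" for t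
    using that by (simp_all add: sum_power2_eq_zero_iff)
  have x: "fst (\<zeta> t) $ 1 = fst (\<eta> t) $ 1" if "t \<in> {0..T}" for t
    by (rule eqI [OF _ that _ d1(4)]) (use d2(4) bc 2(2) in force)+
  have y: "fst (\<zeta> t) $ 2 = fst (\<eta> t) $ 2" if "t \<in> {0..T}" for t
    by (rule eqI [OF _ that _ d1(5)]) (use d2(5) bc 2(2) in force)+
  have "fst (\<zeta> t) $ 3 = fst (\<eta> t) $ 3" if "t \<in> {0..T}" for t
  proof (rule eqI [OF _ that _ d1(6)])
    fix s assume s: "s \<in> {0..T}"
    show "((\<lambda>t. fst (\<zeta> t) $ 3) has_real_derivative
        (fst (\<eta> s) $ 1 * cov_c (\<eta> s) - fst (\<eta> s) $ 2 * cov_b (\<eta> s)) / 2) (at s within {0..T})"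
      using d2(6) [OF s] by (simp add: bc [OF s] x [OF s] y [OF s])
  qed (simp add: 2(2))
  moreover have T: "T \<in> {0..T}"
    using \<open>0 \<le> T\<close> by simp
  ultimately have q: "fst (\<zeta> T) = fst (\<eta> T)"
    using x [OF T] y [OF T] by (simp add: vec_eq_iff forall_3)
  moreover have "snd (\<zeta> T) = snd (\<eta> T)"
  proof (rule blinfun_eqI)
    fix v
    show "blinfun_apply (snd (\<zeta> T)) v = blinfun_apply (snd (\<eta> T)) v"
      using bc [OF T] a [OF T] q
      by (subst (1 2) blinfun_apply_real3) (simp add: cov_a_def cov_b_def cov_c_def)
  qed
  ultimately show ?thesis
    by (simp add: prod_eq_iff)
qed

lemma hamiltonian_flow_max_hamiltonian:
  assumes "0 \<le> T" "hamiltonian_curve max_hamiltonian T \<eta>" "max_hamiltonian (\<eta> 0) = 1"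
  shows "hamiltonian_flow max_hamiltonian T (\<eta> 0) = \<eta> T"
  unfolding hamiltonian_flow_def
  using assms max_hamiltonian_curve_unique by (intro the_equality) blast+

section \<open>The explicit extremal arcs\<close>

text \<open>The motion along the circle of radius \<open>norm (x0, y0) / 2\<close> through \<open>(x0, y0)\<close> and the origin,
  with angular speed \<open>\<omega>\<close>, lifted to a horizontal curve starting in the plane \<open>z = 0\<close>.\<close>

definition arc_x :: "real \<Rightarrow> real \<Rightarrow> real \<Rightarrow> real \<Rightarrow> real" where
  "arc_x x0 y0 \<omega> t = (x0 + x0 * cos (\<omega> * t) - y0 * sin (\<omega> * t)) / 2"

definition arc_y :: "real \<Rightarrow> real \<Rightarrow> real \<Rightarrow> real \<Rightarrow> real" where
  "arc_y x0 y0 \<omega> t = (y0 + x0 * sin (\<omega> * t) + y0 * cos (\<omega> * t)) / 2"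

text \<open>The signed area swept from the origin: a circular sector about the centre plus the
  triangle spanned by the origin, the centre and the current point.\<close>

definition arc_z :: "real \<Rightarrow> real \<Rightarrow> real \<Rightarrow> real \<Rightarrow> real" where
  "arc_z x0 y0 \<omega> t = (x0\<^sup>2 + y0\<^sup>2) * (\<omega> * t + sin (\<omega> * t)) / 8"

text \<open>Together with \<open>arc_v\<close> the planar velocity; along the lifted extremal also
  the coefficients \<open>b\<close> and \<open>c\<close> of the covector.\<close>

definition arc_u :: "real \<Rightarrow> real \<Rightarrow> real \<Rightarrow> real \<Rightarrow> real" where
  "arc_u x0 y0 \<omega> t = - (\<omega> * (x0 * sin (\<omega> * t) + y0 * cos (\<omega> * t)) / 2)"

definition arc_v :: "real \<Rightarrow> real \<Rightarrow> real \<Rightarrow> real \<Rightarrow> real" where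
  "arc_v x0 y0 \<omega> t = \<omega> * (x0 * cos (\<omega> * t) - y0 * sin (\<omega> * t)) / 2"

lemma rotation_norm:
  fixes x0 y0 :: real
  shows "(x0 * sin t + y0 * cos t)\<^sup>2 + (x0 * cos t - y0 * sin t)\<^sup>2 = x0\<^sup>2 + y0\<^sup>2"
  using sin_cos_squared_add [of t] by algebra

lemma arc_deriv:
  shows "(arc_x x0 y0 \<omega> has_real_derivative arc_u x0 y0 \<omega> t) (at t within S)"
    and "(arc_y x0 y0 \<omega> has_real_derivative arc_v x0 y0 \<omega> t) (at t within S)"
    and "(arc_z x0 y0 \<omega> has_real_derivative
      (arc_x x0 y0 \<omega> t * arc_v x0 y0 \<omega> t - arc_y x0 y0 \<omega> t * arc_u x0 y0 \<omega> t) / 2) (at t within S)"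
    and "(arc_u x0 y0 \<omega> has_real_derivative - (\<omega> * arc_v x0 y0 \<omega> t)) (at t within S)"
    and "(arc_v x0 y0 \<omega> has_real_derivative \<omega> * arc_u x0 y0 \<omega> t) (at t within S)"
proof -
  have "(x0\<^sup>2 + y0\<^sup>2) * (\<omega> + \<omega> * cos (\<omega> * t)) / 8 =
      (arc_x x0 y0 \<omega> t * arc_v x0 y0 \<omega> t - arc_y x0 y0 \<omega> t * arc_u x0 y0 \<omega> t) / 2"
  proof -
    \<comment> \<open>\<open>(c, s)\<close> is \<open>(x0, y0)\<close> rotated by
      \<open>\<omega> * t\<close>. The arc is the average of these two points, with velocity
      \<open>\<omega> / 2 * (- s, c)\<close>.\<close>
    define c s where "c = x0 * cos (\<omega> * t) - y0 * sin (\<omega> * t)" and "s = x0 * sin (\<omega> * t) + y0 * cos (\<omega> * t)"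
    have "(x0\<^sup>2 + y0\<^sup>2) * (\<omega> + \<omega> * cos (\<omega> * t)) / 8
        = \<omega> * ((x0\<^sup>2 + y0\<^sup>2) + (x0\<^sup>2 + y0\<^sup>2) * cos (\<omega> * t)) / 8"
      by (simp add: algebra_simps)
    also have "(x0\<^sup>2 + y0\<^sup>2) * cos (\<omega> * t) = x0 * c + y0 * s"
      by (simp add: c_def s_def power2_eq_square algebra_simps)
    also have "x0\<^sup>2 + y0\<^sup>2 = s\<^sup>2 + c\<^sup>2"
      using rotation_norm [of x0 "\<omega> * t" y0] by (simp add: c_def s_def)
    also have "\<omega> * (s\<^sup>2 + c\<^sup>2 + (x0 * c + y0 * s)) / 8
        = ((x0 + c) / 2 * (\<omega> * c / 2) - (y0 + s) / 2 * (- (\<omega> * s / 2))) / 2"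
      by (simp add: power2_eq_square field_simps)
    finally show ?thesis
      unfolding arc_x_def arc_y_def arc_u_def arc_v_def c_def s_def rotation_norm
      by (simp add: algebra_simps)
  qed
  moreover have "(arc_z x0 y0 \<omega> has_real_derivative
      (x0\<^sup>2 + y0\<^sup>2) * (\<omega> + \<omega> * cos (\<omega> * t)) / 8) (at t within S)"
    unfolding arc_z_def [abs_def] by (auto intro!: derivative_eq_intros simp: algebra_simps)
  ultimately show "(arc_z x0 y0 \<omega> has_real_derivative
      (arc_x x0 y0 \<omega> t * arc_v x0 y0 \<omega> t - arc_y x0 y0 \<omega> t * arc_u x0 y0 \<omega> t) / 2) (at t within S)"
    by metis
qed (unfold arc_x_def [abs_def] arc_y_def [abs_def] arc_u_def [abs_def] arc_v_def [abs_def],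
    (auto intro!: derivative_eq_intros simp: field_simps)+)

lemma arc_speed: "(arc_u x0 y0 \<omega> t)\<^sup>2 + (arc_v x0 y0 \<omega> t)\<^sup>2 = \<omega>\<^sup>2 * (x0\<^sup>2 + y0\<^sup>2) / 4"
proof -
  have "(- (\<omega> * s / 2))\<^sup>2 + (\<omega> * c / 2)\<^sup>2 = \<omega>\<^sup>2 * (s\<^sup>2 + c\<^sup>2) / 4" for s c
    by (simp add: power2_eq_square field_simps)
  then show ?thesis
    unfolding arc_u_def arc_v_def rotation_norm [of x0 "\<omega> * t" y0, symmetric] .
qed

lemma hamiltonian_flow_conormal:
  assumes "0 \<le> T" and \<omega>: "\<omega>\<^sup>2 * (x0\<^sup>2 + y0\<^sup>2) = 4"
  shows "fst (hamiltonian_flow max_hamiltonian T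
      (vector [x0, y0, 0], blinfun_inner_right (vector [0, 0, \<omega>]))) =
    vector [arc_x x0 y0 \<omega> T, arc_y x0 y0 \<omega> T, arc_z x0 y0 \<omega> T]"
proof -
  let ?x = "arc_x x0 y0 \<omega>" and ?y = "arc_y x0 y0 \<omega>" and ?z = "arc_z x0 y0 \<omega>"
    and ?u = "arc_u x0 y0 \<omega>" and ?v = "arc_v x0 y0 \<omega>"
  \<comment> \<open>The covector is \<open>\<omega> \<alpha> + u dx + v dy\<close>; expanding
    \<open>\<alpha>\<close> into \<open>dx\<close>, \<open>dy\<close>, \<open>dz\<close> produces
    the terms in \<open>?y\<close> and \<open>?x\<close>.\<close>
  define \<eta> :: "real \<Rightarrow> cotangent" where
    "\<eta> t = (vector [?x t, ?y t, ?z t],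
      blinfun_inner_right (vector [?u t + \<omega> * ?y t / 2, ?v t - \<omega> * ?x t / 2, \<omega>]))" for t
  have \<eta>0: "\<eta> 0 = (vector [x0, y0, 0], blinfun_inner_right (vector [0, 0, \<omega>]))"
    by (simp add: \<eta>_def arc_x_def arc_y_def arc_z_def arc_u_def arc_v_def)
  have cov: "cov_a (\<eta> t) = \<omega>" "cov_b (\<eta> t) = ?u t" "cov_c (\<eta> t) = ?v t" for t
    by (simp_all add: cov_a_def cov_b_def cov_c_def \<eta>_def inner_axis)
  have h: "max_hamiltonian (\<eta> t) = 1" for t
    using \<omega> by (simp add: max_hamiltonian_eq_1_iff cov arc_speed)
  have "(\<eta> has_vector_derivative hamiltonian_field (\<eta> t)) (at t within {0..T})" for t
  proof -
    have "((\<lambda>t. vector [?x t, ?y t, ?z t] :: real^3) has_vector_derivative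
        vector [?u t, ?v t, (?x t * ?v t - ?y t * ?u t) / 2]) (at t within {0..T})"
      by (intro has_vector_derivative_vector3 arc_deriv)
    moreover have "((\<lambda>t. vector [?u t + \<omega> * ?y t / 2, ?v t - \<omega> * ?x t / 2, \<omega>] :: real^3)
        has_vector_derivative vector [- (\<omega> * ?v t / 2), \<omega> * ?u t / 2, 0]) (at t within {0..T})"
      by (intro has_vector_derivative_vector3)
        (auto intro!: derivative_eq_intros arc_deriv simp: field_simps)
    ultimately show ?thesis
      unfolding \<eta>_def [abs_def, symmetric] hamiltonian_field_def cov
      unfolding \<eta>_def
      by (auto intro!: has_vector_derivative_Pair
          bounded_linear.has_vector_derivative [OF bounded_linear_blinfun_inner_right])
  qed
  then have "hamiltonian_curve max_hamiltonian T \<eta>"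
    by (simp add: hamiltonian_curve_max_hamiltonian_iff h)
  from hamiltonian_flow_max_hamiltonian [OF \<open>0 \<le> T\<close> this h] show ?thesis
    by (simp add: \<eta>0) (simp add: \<eta>_def)
qed

section \<open>The attainable set\<close>

text \<open>The derivative of \<open>r t / 4 + tan (t / r) (x\<^sup>2 + y\<^sup>2) / 4 - \<sigma> z\<close> along a horizontal curve is
  a nonnegative combination of \<open>1 - x'\<^sup>2 - y'\<^sup>2\<close> and two squares, which vanish along the extremal arc.\<close>

lemma horizontal_rate_nonneg:
  fixes r k x y v1 v2 \<sigma> :: real
  assumes "r > 0" "\<sigma>\<^sup>2 = 1" "v1 * v1 + v2 * v2 \<le> 1"
  shows "0 \<le> r / 4 + ((1 + k\<^sup>2) / r * (x\<^sup>2 + y\<^sup>2) + k * (2 * x * v1 + 2 * y * v2)) / 4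
    - \<sigma> * ((x * v2 - y * v1) / 2)"
proof -
  have "0 \<le> r / 4 * (1 - (v1 * v1 + v2 * v2))
      + r / 4 * ((v1 + (k * x + \<sigma> * y) / r)\<^sup>2 + (v2 + (k * y - \<sigma> * x) / r)\<^sup>2)"
    using assms by (intro add_nonneg_nonneg mult_nonneg_nonneg) auto
  also have "\<dots> = r / 4 + ((\<sigma>\<^sup>2 + k\<^sup>2) / r * (x\<^sup>2 + y\<^sup>2) + k * (2 * x * v1 + 2 * y * v2)) / 4
    - \<sigma> * ((x * v2 - y * v1) / 2)"
    using \<open>r > 0\<close> by (simp add: power2_eq_square field_simps)
  finally show ?thesis
    using assms by simp
qed

text \<open>A calibration argument: \<open>\<Phi>\<close> is Lipschitz with nonnegative derivative
  almost everywhere, and \<open>\<Phi> 0 = 0\<close> for every starting point in \<open>H\<close>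
  because \<open>tan 0 = 0\<close>. Strictness of \<open>2 * T / pi < r\<close> keeps
  \<open>t / r\<close> away from the pole of the tangent.\<close>

lemma horizontal_curve_bound:
  fixes \<gamma> :: "real \<Rightarrow> real^3"
  assumes "T > 0" and r: "2 * T / pi < r" and \<sigma>: "\<sigma>\<^sup>2 = 1"
    and L: "L-lipschitz_on {0..T} \<gamma>" and 0: "\<gamma> 0 $ 3 = 0"
    and AE: "AE t in lebesgue_on {0..T}. \<exists>v. (\<gamma> has_vector_derivative v) (at t within {0..T}) \<and>
      v \<in> xi_std (\<gamma> t) \<and> g_std v v \<le> 1"
  shows "\<sigma> * \<gamma> T $ 3 \<le> r * T / 4 + tan (T / r) * ((\<gamma> T $ 1)\<^sup>2 + (\<gamma> T $ 2)\<^sup>2) / 4"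
proof -
  define \<Phi> where "\<Phi> t = r / 4 * t
    + (1 / 4) * (tan (t / r) * (\<gamma> t $ 1 * \<gamma> t $ 1 + \<gamma> t $ 2 * \<gamma> t $ 2)) + (- \<sigma>) * \<gamma> t $ 3" for t
  have "r > 0"
    using launch_angle_bounds(1) [of T r] r \<open>T > 0\<close> by simp
  have cos: "cos (t / r) > 0" if "t \<in> {0..T}" for t
  proof (rule cos_gt_zero_pi)
    have "t / r \<le> T / r"
      using that \<open>r > 0\<close> by (simp add: divide_right_mono)
    also have "T / r < pi / 2"
      using r \<open>r > 0\<close> by (simp add: field_simps)
    finally show "t / r < pi / 2" .
    show "- (pi / 2) < t / r"
    proof -
      have "0 \<le> t / r"
        using that \<open>r > 0\<close> by simp
      then show ?thesis
        using pi_gt_zero by linarith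
    qed
  qed
  have tan: "((\<lambda>t. tan (t / r)) has_real_derivative (1 + (tan (t / r))\<^sup>2) / r) (at t within {0..T})"
    if "t \<in> {0..T}" for t
  proof -
    have "cos (t / r) \<noteq> 0"
      using cos [OF that] by simp
    then have "((\<lambda>t. tan (t / r)) has_real_derivative inverse ((cos (t / r))\<^sup>2) * (1 / r)) (at t within {0..T})"
      by (intro DERIV_chain2 [OF DERIV_tan] DERIV_cdivide DERIV_ident)
    with \<open>cos (t / r) \<noteq> 0\<close> show ?thesis
      by (simp add: tan_sec power_inverse)
  qed
  have "\<exists>L. L-lipschitz_on {0..T} (\<lambda>t. tan (t / r))"
  proof (rule C1_imp_lipschitz_on_Icc)
    show "((\<lambda>t. tan (t / r)) has_vector_derivative (1 + (tan (t / r))\<^sup>2) / r) (at t within {0..T})"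
      if "t \<in> {0..T}" for t
      using tan [OF that] by (simp add: has_real_derivative_iff_has_vector_derivative)
    show "continuous_on {0..T} (\<lambda>t. (1 + (tan (t / r))\<^sup>2) / r)"
      using \<open>r > 0\<close> cos by (intro continuous_intros) force+
  qed
  moreover have "\<exists>L. L-lipschitz_on {0..T} (\<lambda>t. \<gamma> t $ i)" for i
    using lipschitz_on_vec_nth [OF L] by blast
  then have "\<exists>L. L-lipschitz_on {0..T} (\<lambda>t. \<gamma> t $ i * \<gamma> t $ i)" for i
    by (intro lipschitz_on_compact_mult) auto
  from this [of 1] this [of 2]
  have "\<exists>L. L-lipschitz_on {0..T} (\<lambda>t. \<gamma> t $ 1 * \<gamma> t $ 1 + \<gamma> t $ 2 * \<gamma> t $ 2)"
    by (auto intro: lipschitz_on_add)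
  ultimately obtain M where M:
    "M-lipschitz_on {0..T} (\<lambda>t. tan (t / r) * (\<gamma> t $ 1 * \<gamma> t $ 1 + \<gamma> t $ 2 * \<gamma> t $ 2))"
    using lipschitz_on_compact_mult [of "{0..T}"] by blast
  have lip: "(\<bar>r / 4\<bar> * 1 + \<bar>1 / 4\<bar> * M + \<bar>- \<sigma>\<bar> * L)-lipschitz_on {0..T} \<Phi>"
    unfolding \<Phi>_def [abs_def]
    by (intro lipschitz_on_add lipschitz_on_cmult_real lipschitz_on_id M lipschitz_on_vec_nth [OF L])
  have "AE t in lebesgue_on {0..T}. \<exists>d\<ge>0. (\<Phi> has_real_derivative d) (at t within {0..T})"
    using AE
  proof (rule AE_mp, intro AE_I2 impI)
    fix t assume "t \<in> space (lebesgue_on {0..T})"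
      and "\<exists>v. (\<gamma> has_vector_derivative v) (at t within {0..T}) \<and> v \<in> xi_std (\<gamma> t) \<and> g_std v v \<le> 1"
    then obtain v where t: "t \<in> {0..T}" and v: "(\<gamma> has_vector_derivative v) (at t within {0..T})"
      and xi: "v $ 3 = (\<gamma> t $ 1 * v $ 2 - \<gamma> t $ 2 * v $ 1) / 2"
      and g: "v $ 1 * v $ 1 + v $ 2 * v $ 2 \<le> 1"
      by (auto simp: xi_std_def contact_form_def g_std_def)
    have \<gamma>: "((\<lambda>t. \<gamma> t $ i) has_real_derivative v $ i) (at t within {0..T})" for i
      using bounded_linear.has_vector_derivative [OF bounded_linear_vec_nth v]
      by (simp add: has_real_derivative_iff_has_vector_derivative)
    have "(\<Phi> has_real_derivative r / 4
        + ((1 + (tan (t / r))\<^sup>2) / r * ((\<gamma> t $ 1)\<^sup>2 + (\<gamma> t $ 2)\<^sup>2)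
          + tan (t / r) * (2 * \<gamma> t $ 1 * v $ 1 + 2 * \<gamma> t $ 2 * v $ 2)) / 4
        - \<sigma> * ((\<gamma> t $ 1 * v $ 2 - \<gamma> t $ 2 * v $ 1) / 2)) (at t within {0..T})"
      unfolding \<Phi>_def [abs_def]
      by (rule \<gamma> tan [OF t] derivative_eq_intros refl)+
        (simp add: xi power2_eq_square algebra_simps, simp add: field_simps)
    then show "\<exists>d\<ge>0. (\<Phi> has_real_derivative d) (at t within {0..T})"
      using horizontal_rate_nonneg [OF \<open>r > 0\<close> \<sigma> g] by blast
  qed
  then have "\<Phi> 0 \<le> \<Phi> T"
    using lipschitz_AE_deriv_nonneg_imp_le [OF _ lip] \<open>T > 0\<close> by simp
  then show ?thesis
    by (simp add: \<Phi>_def 0 power2_eq_square)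
qed

lemma cyl_radius_sq: "(cyl_radius q)\<^sup>2 = (q $ 1)\<^sup>2 + (q $ 2)\<^sup>2"
  by (simp add: cyl_radius_def)

lemma cyl_radius_nonneg: "0 \<le> cyl_radius q"
  by (simp add: cyl_radius_def)

lemma attainable_imp_le_height:
  assumes "T > 0" "q \<in> attainable_set plane_H T"
  shows "\<bar>q $ 3\<bar> \<le> height T (cyl_radius q)"
proof -
  let ?\<rho> = "cyl_radius q"
  have bound: "\<sigma> * q $ 3 \<le> r * T / 4 + tan (T / r) * ?\<rho>\<^sup>2 / 4"
    if "\<sigma>\<^sup>2 = 1" "2 * T / pi < r" for \<sigma> r
    using assms(2) horizontal_curve_bound [OF \<open>T > 0\<close> that(2,1)]
    by (auto simp: attainable_set_def plane_H_def cyl_radius_sq)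
  have "\<sigma> * q $ 3 \<le> height T ?\<rho>" if \<sigma>: "\<sigma>\<^sup>2 = 1" for \<sigma>
  proof (cases "?\<rho> = 0")
    \<comment> \<open>On the axis the optimal radius \<open>2 * T / pi\<close> is excluded from
      \<open>bound\<close>, so it is approached from above.\<close>
    case True
    have "\<sigma> * q $ 3 * 4 / T \<le> r" if "2 * T / pi < r" for r
      using bound [OF \<sigma> that] \<open>T > 0\<close> by (simp add: True field_simps)
    then have "\<sigma> * q $ 3 * 4 / T \<le> 2 * T / pi"
      by (rule dense_ge)
    then show ?thesis
      using \<open>T > 0\<close> by (simp add: True height_def launch_radius_0 field_simps)
  next
    case False
    then have "?\<rho> > 0"
      using cyl_radius_nonneg [of q] by simp
    let ?r = "launch_radius T ?\<rho>"
    have e: "?r * cos (T / ?r) = ?\<rho>"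
      using exit_launch_radius [OF \<open>T > 0\<close> cyl_radius_nonneg] .
    with False have "cos (T / ?r) \<noteq> 0"
      by auto
    \<comment> \<open>Off the axis \<open>?r\<close> itself is admissible, and its defining equation
      \<open>e\<close> turns the tangent term of \<open>bound\<close> into the sine term of
      \<open>height\<close>.\<close>
    then have "tan (T / ?r) * (?r * cos (T / ?r)) = ?r * sin (T / ?r)"
      by (simp add: tan_def)
    then have "tan (T / ?r) * ?\<rho>\<^sup>2 = ?r * ?\<rho> * sin (T / ?r)"
      unfolding e by (simp add: power2_eq_square)
    then show ?thesis
      using bound [OF \<sigma> launch_radius_gt [OF \<open>T > 0\<close> \<open>?\<rho> > 0\<close>]] by (simp add: height_def)
  qed
  from this [of 1] this [of "-1"] show ?thesis
    by simp
qed

section \<open>Endpoints of the arcs and attainability\<close>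

text \<open>The inscribed angle theorem: as the origin lies on the circle, the position is
  \<open>(x0, y0)\<close> rotated by half the central angle and scaled by its cosine.\<close>

lemma arc_half_angle:
  shows "arc_x x0 y0 \<omega> t = cos (\<omega> * t / 2) * (x0 * cos (\<omega> * t / 2) - y0 * sin (\<omega> * t / 2))"
    and "arc_y x0 y0 \<omega> t = cos (\<omega> * t / 2) * (x0 * sin (\<omega> * t / 2) + y0 * cos (\<omega> * t / 2))"
    and "arc_z x0 y0 \<omega> t = (x0\<^sup>2 + y0\<^sup>2) * (\<omega> * t / 2 + cos (\<omega> * t / 2) * sin (\<omega> * t / 2)) / 4"
proof -
  define h where "h = \<omega> * t / 2"
  then have h: "\<omega> * t = 2 * h"
    by simp
  show "arc_x x0 y0 \<omega> t = cos (\<omega> * t / 2) * (x0 * cos (\<omega> * t / 2) - y0 * sin (\<omega> * t / 2))"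
    and "arc_y x0 y0 \<omega> t = cos (\<omega> * t / 2) * (x0 * sin (\<omega> * t / 2) + y0 * cos (\<omega> * t / 2))"
    and "arc_z x0 y0 \<omega> t = (x0\<^sup>2 + y0\<^sup>2) * (\<omega> * t / 2 + cos (\<omega> * t / 2) * sin (\<omega> * t / 2)) / 4"
    unfolding arc_x_def arc_y_def arc_z_def h cos_double_cos sin_double
    by (simp_all add: power2_eq_square field_simps)
qed

lemma sign_cases: "\<sigma>\<^sup>2 = 1 \<longleftrightarrow> \<sigma> = 1 \<or> \<sigma> = (-1 :: real)"
  by (simp add: power2_eq_1_iff)

text \<open>This \<open>\<omega>\<close> gives unit speed on a circle of diameter \<open>r\<close>,
  with half angle \<open>\<sigma> * (T / r)\<close> at time \<open>T\<close>. The sign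
  \<open>\<sigma>\<close> is the sense of rotation and hence the sign of the height.\<close>

lemma arc_end:
  assumes "T > 0" and r: "2 * T / pi \<le> r" "x0\<^sup>2 + y0\<^sup>2 = r\<^sup>2" and \<sigma>: "\<sigma>\<^sup>2 = 1" and \<omega>: "\<omega> = 2 * \<sigma> / r"
  shows "sqrt ((arc_x x0 y0 \<omega> T)\<^sup>2 + (arc_y x0 y0 \<omega> T)\<^sup>2) = r * cos (T / r)"
    and "arc_z x0 y0 \<omega> T = \<sigma> * height T (r * cos (T / r))"
proof -
  note b = launch_angle_bounds [OF \<open>T > 0\<close> r(1)]
  have \<omega>T: "\<omega> * T / 2 = \<sigma> * (T / r)"
    by (simp add: \<omega>)
  have cs: "cos (\<sigma> * (T / r)) = cos (T / r)" "sin (\<sigma> * (T / r)) = \<sigma> * sin (T / r)"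
    using \<sigma> unfolding sign_cases by auto
  have "(arc_x x0 y0 \<omega> T)\<^sup>2 + (arc_y x0 y0 \<omega> T)\<^sup>2 = (r * cos (T / r))\<^sup>2"
    using rotation_norm [of x0 "\<omega> * T / 2" y0] r(2)
    unfolding arc_half_angle \<omega>T cs(1) by algebra
  moreover have "0 \<le> r * cos (T / r)"
    using b by (intro mult_nonneg_nonneg cos_ge_zero) auto
  ultimately show "sqrt ((arc_x x0 y0 \<omega> T)\<^sup>2 + (arc_y x0 y0 \<omega> T)\<^sup>2) = r * cos (T / r)"
    by simp
  show "arc_z x0 y0 \<omega> T = \<sigma> * height T (r * cos (T / r))"
    using b(1) unfolding arc_half_angle \<omega>T cs r(2) height_def launch_radius_unique [OF \<open>T > 0\<close> r(1)]
    by (simp add: power2_eq_square field_simps)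
qed

text \<open>The half-angle formulas are solved for the starting point: divide the endpoint by
  \<open>cos \<theta>\<close>, then rotate back by \<open>\<theta>\<close>.\<close>

lemma arc_through:
  assumes "T > 0" and \<rho>: "\<rho> = sqrt (a\<^sup>2 + b\<^sup>2)" and r: "r = launch_radius T \<rho>" and \<sigma>: "\<sigma>\<^sup>2 = 1"
    and \<omega>: "\<omega> = 2 * \<sigma> / r"
  obtains x0 y0 where "x0\<^sup>2 + y0\<^sup>2 = r\<^sup>2"
    "arc_x x0 y0 \<omega> T = a" "arc_y x0 y0 \<omega> T = b" "arc_z x0 y0 \<omega> T = \<sigma> * height T \<rho>"
proof -
  have "\<rho> \<ge> 0"
    by (simp add: \<rho>)
  note r2 = launch_radius [OF \<open>T > 0\<close> this, folded r]
  define \<theta> where "\<theta> = \<omega> * T / 2"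
  have \<theta>: "\<theta> = \<sigma> * (T / r)"
    by (simp add: \<omega> \<theta>_def)
  have cos: "r * cos \<theta> = \<rho>"
    using \<sigma> r2 unfolding sign_cases \<theta> by auto
  obtain e f where ef: "e\<^sup>2 + f\<^sup>2 = r\<^sup>2" "cos \<theta> * e = a" "cos \<theta> * f = b"
  proof (cases "\<rho> = 0")
    \<comment> \<open>For an endpoint on the axis \<open>cos \<theta>\<close> vanishes and every
      pair \<open>(e, f)\<close> of norm \<open>r\<close> works; \<open>(r, 0)\<close> is one
      choice.\<close>
    case True
    with \<rho> have "a = 0" "b = 0"
      by (auto simp: sum_power2_eq_zero_iff)
    moreover have "cos \<theta> = 0"
      using cos True launch_angle_bounds(1) [OF \<open>T > 0\<close> r2(1)] by simp
    ultimately show ?thesis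
      using that [of r 0] by simp
  next
    case False
    with cos have c: "cos \<theta> \<noteq> 0"
      by auto
    have "a\<^sup>2 + b\<^sup>2 = (r * cos \<theta>)\<^sup>2"
      unfolding cos by (simp add: \<rho>)
    with c show ?thesis
      by (intro that [of "a / cos \<theta>" "b / cos \<theta>"]) (simp_all add: power_divide field_simps)
  qed
  let ?x0 = "e * cos \<theta> + f * sin \<theta>" and ?y0 = "f * cos \<theta> - e * sin \<theta>"
  have "?x0\<^sup>2 + ?y0\<^sup>2 = r\<^sup>2"
    unfolding ef(1) [symmetric] using sin_cos_squared_add [of \<theta>] by algebra
  moreover have "?x0 * cos \<theta> - ?y0 * sin \<theta> = e" "?x0 * sin \<theta> + ?y0 * cos \<theta> = f"
    using sin_cos_squared_add [of \<theta>] by algebra+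
  then have "arc_x ?x0 ?y0 \<omega> T = a" "arc_y ?x0 ?y0 \<omega> T = b"
    by (simp_all only: arc_half_angle ef flip: \<theta>_def)
  ultimately show thesis
    using that arc_end(2) [OF \<open>T > 0\<close> r2(1) _ \<sigma> \<omega>] r2(2) by metis
qed

text \<open>The planar arc ending at \<open>(a, b)\<close> is contracted towards its endpoint: the homothety by
  \<open>s \<in> {0..1}\<close> decreases the speed and moves the height of the endpoint continuously from \<open>0\<close> to
  its extremal value.\<close>

lemma le_height_imp_attainable:
  assumes "T > 0" and le: "\<bar>q $ 3\<bar> \<le> height T (cyl_radius q)"
  shows "q \<in> attainable_set plane_H T"
proof -
  define \<rho> r where "\<rho> = cyl_radius q" and "r = launch_radius T \<rho>"
  have \<rho>: "\<rho> = sqrt ((q $ 1)\<^sup>2 + (q $ 2)\<^sup>2)"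
    by (simp add: \<rho>_def cyl_radius_def)
  obtain \<sigma> :: real where \<sigma>: "\<sigma>\<^sup>2 = 1" "\<sigma> * \<bar>q $ 3\<bar> = q $ 3"
    using that [of "if q $ 3 \<ge> 0 then 1 else -1"] by simp
  define \<omega> where "\<omega> = 2 * \<sigma> / r"
  have "r > 0"
    unfolding r_def \<rho>_def
    by (intro launch_angle_bounds(1) [OF \<open>T > 0\<close>] launch_radius_ge [OF \<open>T > 0\<close>] cyl_radius_nonneg)
  obtain x0 y0 where xy0: "x0\<^sup>2 + y0\<^sup>2 = r\<^sup>2"
    and fin: "arc_x x0 y0 \<omega> T = q $ 1" "arc_y x0 y0 \<omega> T = q $ 2" "arc_z x0 y0 \<omega> T = \<sigma> * height T \<rho>"
    using arc_through [OF \<open>T > 0\<close> \<rho> r_def \<sigma>(1) \<omega>_def] .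
  let ?x = "arc_x x0 y0 \<omega>" and ?y = "arc_y x0 y0 \<omega>" and ?z = "arc_z x0 y0 \<omega>"
    and ?u = "arc_u x0 y0 \<omega>" and ?v = "arc_v x0 y0 \<omega>"
  \<comment> \<open>With \<open>Q\<close> the endpoint and \<open>P\<close> the planar arc, the
    contracted curve is \<open>(1 - s) * Q + s * P\<close>. Its swept area is
    \<open>s * (1 - s) * A + s\<^sup>2 * ?z T\<close>, where \<open>A\<close> is half the cross
    product of \<open>Q\<close> with the displacement of \<open>P\<close>.\<close>
  define A where "A = (q $ 1 * (?y T - ?y 0) - q $ 2 * (?x T - ?x 0)) / 2"
  \<comment> \<open>The factor \<open>\<sigma>\<close> brings both signs of \<open>q $ 3\<close> to
    the one equation \<open>\<zeta> s = \<bar>q $ 3\<bar>\<close>.\<close>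
  define \<zeta> where "\<zeta> s = \<sigma> * (s * (1 - s) * A + s\<^sup>2 * ?z T)" for s
  have "\<zeta> 0 = 0" "\<zeta> 1 = height T \<rho>"
    using \<sigma>(1) by (auto simp: \<zeta>_def fin sign_cases)
  moreover have "continuous_on {0..1} \<zeta>"
    unfolding \<zeta>_def by (intro continuous_intros)
  ultimately obtain s where s: "0 \<le> s" "s \<le> 1" "\<zeta> s = \<bar>q $ 3\<bar>"
    using IVT' [of \<zeta> 0 "\<bar>q $ 3\<bar>" 1] le by (auto simp: \<rho>_def)
  have "s * (1 - s) * A + s\<^sup>2 * ?z T = \<sigma>\<^sup>2 * (s * (1 - s) * A + s\<^sup>2 * ?z T)"
    by (simp only: \<sigma>(1) mult_1_left)
  also have "\<dots> = \<sigma> * \<zeta> s"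
    by (simp only: \<zeta>_def power2_eq_square [of \<sigma>] mult.assoc)
  also have "\<dots> = q $ 3"
    by (simp only: s(3) \<sigma>(2))
  finally have q3: "s * (1 - s) * A + s\<^sup>2 * ?z T = q $ 3" .
  define \<gamma> :: "real \<Rightarrow> real^3" where
    "\<gamma> t = vector [q $ 1 + s * (?x t - q $ 1), q $ 2 + s * (?y t - q $ 2),
      s * (1 - s) * ((q $ 1 * (?y t - ?y 0) - q $ 2 * (?x t - ?x 0)) / 2) + s\<^sup>2 * ?z t]" for t
  define \<gamma>' :: "real \<Rightarrow> real^3" where
    "\<gamma>' t = vector [s * ?u t, s * ?v t,
      s * (1 - s) * ((q $ 1 * ?v t - q $ 2 * ?u t) / 2) + s\<^sup>2 * ((?x t * ?v t - ?y t * ?u t) / 2)]" for t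
  have deriv: "(\<gamma> has_vector_derivative \<gamma>' t) (at t within S)" for t S
    unfolding \<gamma>_def [abs_def] \<gamma>'_def
    by (rule has_vector_derivative_vector3)
      ((rule arc_deriv derivative_eq_intros refl)+, simp add: field_simps)+
  have xi: "\<gamma>' t \<in> xi_std (\<gamma> t)" for t
    by (simp add: xi_std_def contact_form_def \<gamma>_def \<gamma>'_def power2_eq_square field_simps)
  have g: "g_std (\<gamma>' t) (\<gamma>' t) \<le> 1" for t
  proof -
    have "\<omega>\<^sup>2 * r\<^sup>2 = 4"
      using \<open>r > 0\<close> \<sigma>(1) by (simp add: \<omega>_def power_divide power_mult_distrib)
    then have "(?u t)\<^sup>2 + (?v t)\<^sup>2 = 1"
      by (simp add: arc_speed xy0)
    moreover have "g_std (\<gamma>' t) (\<gamma>' t) = s\<^sup>2 * ((?u t)\<^sup>2 + (?v t)\<^sup>2)"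
      by (simp add: g_std_def \<gamma>'_def power2_eq_square algebra_simps)
    ultimately show ?thesis
      using s by (simp add: power_le_one)
  qed
  have "continuous_on {0..T} \<gamma>'"
    unfolding \<gamma>'_def [abs_def] vector3_eq_axis
    by (intro continuous_intros DERIV_continuous_on [OF arc_deriv(1)] DERIV_continuous_on [OF arc_deriv(2)]
        DERIV_continuous_on [OF arc_deriv(4)] DERIV_continuous_on [OF arc_deriv(5)]) simp_all
  then have "\<exists>L. L-lipschitz_on {0..T} \<gamma>"
    by (rule C1_imp_lipschitz_on_Icc [OF deriv])
  moreover have "\<gamma> 0 \<in> plane_H"
    by (simp add: \<gamma>_def plane_H_def arc_z_def)
  moreover have "AE t in lebesgue_on {0..T}. \<exists>v. (\<gamma> has_vector_derivative v) (at t within {0..T}) \<and>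
      v \<in> xi_std (\<gamma> t) \<and> g_std v v \<le> 1"
    by (rule AE_I2, rule exI, intro conjI, rule deriv, rule xi, rule g)
  moreover have "\<gamma> T = vector [q $ 1 + s * (?x T - q $ 1), q $ 2 + s * (?y T - q $ 2), q $ 3]"
    unfolding \<gamma>_def A_def [symmetric] q3 ..
  then have "q = \<gamma> T"
    by (simp add: fin vector3_collapse)
  ultimately show ?thesis
    unfolding attainable_set_def by blast
qed

lemma attainable_set_plane_H:
  assumes "T > 0"
  shows "attainable_set plane_H T = {q. \<bar>q $ 3\<bar> \<le> height T (cyl_radius q)}"
  using attainable_imp_le_height [OF assms] le_height_imp_attainable [OF assms] by blast

section \<open>The frontier and its two graphs\<close>

lemma cyl_radius_eq_norm: "cyl_radius q = norm (vector [q $ 1, q $ 2] :: real^2)"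
  by (simp add: cyl_radius_def norm_vec_def L2_set_def sum_2)

lemma continuous_on_vector2: "continuous_on X (\<lambda>q :: real^3. vector [q $ 1, q $ 2] :: real^2)"
proof -
  have "(vector [a, b] :: real^2) = a *\<^sub>R axis 1 1 + b *\<^sub>R axis 2 1" for a b
    by (simp add: vec_eq_iff forall_2 axis_def)
  then show ?thesis
    by (simp only:) (intro continuous_intros)
qed

lemma continuous_on_height_cyl_radius:
  assumes "T > 0"
  shows "continuous_on X (\<lambda>q. height T (cyl_radius q))"
  unfolding cyl_radius_eq_norm
  by (rule continuous_on_compose2 [OF continuous_on_height_norm [OF assms, of UNIV] continuous_on_vector2]) auto

text \<open>The set is closed, so only its interior is in question. At a point of equality a small
  vertical push away from \<open>H\<close> keeps the distance to the axis and so leaves the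
  set.\<close>

lemma frontier_attainable_set:
  assumes "T > 0"
  shows "frontier (attainable_set plane_H T) = {q. \<bar>q $ 3\<bar> = height T (cyl_radius q)}"
proof -
  let ?D = "{q. \<bar>q $ 3\<bar> \<le> height T (cyl_radius q)}"
  have "closed ?D"
    by (intro closed_Collect_le continuous_on_height_cyl_radius assms continuous_intros)
  moreover have "interior ?D = {q. \<bar>q $ 3\<bar> < height T (cyl_radius q)}"
  proof (rule interior_unique)
    show "open {q. \<bar>q $ 3\<bar> < height T (cyl_radius q)}"
      by (intro open_Collect_less continuous_on_height_cyl_radius assms continuous_intros)
    fix U assume U: "U \<subseteq> ?D" "open U"
    show "U \<subseteq> {q. \<bar>q $ 3\<bar> < height T (cyl_radius q)}"
    proof (rule ccontr)
      assume "\<not> ?thesis"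
      with U obtain q where q: "q \<in> U" "\<bar>q $ 3\<bar> = height T (cyl_radius q)"
        by force
      obtain e where "e > 0" and e: "ball q e \<subseteq> U"
        using U q openE by blast
      \<comment> \<open>Positivity of \<open>height\<close> makes \<open>sgn (q $ 3)\<close>
        nonzero, and the length \<open>e / 2\<close> stays inside the ball.\<close>
      define p where "p = q + (e / 2 * sgn (q $ 3)) *\<^sub>R axis 3 1"
      have "q $ 3 \<noteq> 0"
        using q height_pos [OF assms cyl_radius_nonneg, of q] by auto
      then have "\<bar>p $ 3\<bar> > \<bar>q $ 3\<bar>" "cyl_radius p = cyl_radius q"
        using \<open>e > 0\<close> by (auto simp: p_def axis_def cyl_radius_def sgn_if)
      moreover have "p \<in> ball q e"
        using \<open>e > 0\<close> by (auto simp: p_def dist_norm sgn_if)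
      ultimately show False
        using e U q by force
    qed
  qed auto
  ultimately show ?thesis
    by (auto simp: frontier_def attainable_set_plane_H [OF assms])
qed

lemma connected_graph_over_H:
  assumes "continuous_on UNIV f"
  shows "connected (graph_over_H f)"
proof -
  let ?g = "\<lambda>p :: real^2. vector [p $ 1, p $ 2, f p] :: real^3"
  have "vector [p $ 1, p $ 2] = p" for p :: "real^2"
    by (simp add: vec_eq_iff forall_2)
  then have "graph_over_H f = range ?g"
    by (fastforce simp: graph_over_H_def image_iff vec_eq_iff [where 'b = 3] forall_3
        intro: exI [of _ "vector [_ $ 1, _ $ 2]"])
  moreover have "continuous_on UNIV ?g"
    unfolding vector3_eq_axis by (intro continuous_intros assms)
  ultimately show ?thesis
    by (simp only: connected_continuous_image [OF _ connected_UNIV])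
qed

lemma closed_graph_over_H:
  assumes "continuous_on UNIV f"
  shows "closed (graph_over_H f)"
  unfolding graph_over_H_def
  by (intro closed_Collect_eq continuous_intros continuous_on_compose2 [OF assms continuous_on_vector2]) auto

lemma graph_over_H_nonempty: "graph_over_H f \<noteq> {}"
proof -
  have "vector [0, 0, f (vector [0, 0])] \<in> graph_over_H f"
    by (simp add: graph_over_H_def)
  then show ?thesis
    by blast
qed

text \<open>A connected subset of the union cannot meet both of two disjoint closed sets, so each of
  them is a maximal connected subset.\<close>

lemma components_Un_closed:
  assumes "closed A" "closed B" "connected A" "connected B" "A \<noteq> {}" "B \<noteq> {}" "A \<inter> B = {}"
  shows "components (A \<union> B) = {A, B}"
proof -
  have comp: "A \<in> components (A \<union> B)"
    if "closed A" "closed B" "connected A" "A \<noteq> {}" "A \<inter> B = {}" for A B :: "'a set"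
    unfolding in_components_maximal
  proof (intro conjI allI impI)
    fix D assume D: "D \<noteq> {} \<and> A \<subseteq> D \<and> D \<subseteq> A \<union> B \<and> connected D"
    then have "A \<inter> D = {} \<or> B \<inter> D = {}"
      using connected_closedD [of D A B] that by blast
    then show "D = A"
      using D that by blast
  qed (use that in auto)
  have AB: "A \<in> components (A \<union> B)" "B \<in> components (A \<union> B)"
    using comp [of A B] comp [of B A] assms by (auto simp: Un_commute Int_commute)
  have "C = A \<or> C = B" if "C \<in> components (A \<union> B)" for C
    using in_components_nonempty [OF that] in_components_subset [OF that]
      components_eq [OF that AB(1)] components_eq [OF that AB(2)] by blast
  with AB show ?thesis
    by blast
qed

section \<open>Unit conormal covectors and their image under the flow\<close>

text \<open>A covector annihilating the plane is \<open>\<omega> dz\<close>. It has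
  \<open>b = - \<omega> * y0 / 2\<close> and \<open>c = \<omega> * x0 / 2\<close>, which gives the
  level condition.\<close>

lemma conormal_cases:
  assumes "w \<in> Ann_TH r0 \<inter> unit_level_set"
  obtains x0 y0 \<omega> where "w = (vector [x0, y0, 0], blinfun_inner_right (vector [0, 0, \<omega>]))"
    "\<omega>\<^sup>2 * (x0\<^sup>2 + y0\<^sup>2) = 4" "r0 \<le> sqrt (x0\<^sup>2 + y0\<^sup>2)"
proof -
  obtain q l where w: "w = (q, l)" "q $ 3 = 0" "r0 \<le> cyl_radius q" and l: "\<And>v. v $ 3 = 0 \<Longrightarrow> blinfun_apply l v = 0"
    and u: "max_hamiltonian (q, l) = 1"
    using assms by (auto simp: Ann_TH_def unit_level_set_def plane_H_def)
  define \<omega> where "\<omega> = blinfun_apply l (axis 3 1)"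
  have l0: "blinfun_apply l (axis 1 1) = 0" "blinfun_apply l (axis 2 1) = 0"
    by (auto intro!: l simp: axis_def)
  have "l = blinfun_inner_right (vector [0, 0, \<omega>])"
    by (intro blinfun_eqI, subst blinfun_apply_real3) (simp add: l0 \<omega>_def inner_vec_def sum_3)
  moreover have "q = vector [q $ 1, q $ 2, 0]"
    using w by (simp add: vec_eq_iff forall_3)
  moreover have "\<omega>\<^sup>2 * ((q $ 1)\<^sup>2 + (q $ 2)\<^sup>2) = 4"
    using u by (simp add: max_hamiltonian_eq_1_iff cov_a_def cov_b_def cov_c_def l0 \<omega>_def power_divide
        power_mult_distrib algebra_simps)
  ultimately show ?thesis
    using that [of "q $ 1" "q $ 2" \<omega>] w by (simp add: cyl_radius_def)
qed

lemma conormalI: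
  assumes "\<omega>\<^sup>2 * (x0\<^sup>2 + y0\<^sup>2) = 4" "r0 \<le> sqrt (x0\<^sup>2 + y0\<^sup>2)"
  shows "(vector [x0, y0, 0], blinfun_inner_right (vector [0, 0, \<omega>])) \<in> Ann_TH r0 \<inter> unit_level_set"
  using assms
  by (simp add: Ann_TH_def unit_level_set_def plane_H_def cyl_radius_def max_hamiltonian_eq_1_iff
      cov_a_def cov_b_def cov_c_def inner_vec_def sum_3 axis_def power_divide power_mult_distrib
      algebra_simps)

lemma flow_image_conormal:
  assumes "T > 0"
  shows "(fst \<circ> hamiltonian_flow max_hamiltonian T) ` (Ann_TH (2 * T / pi) \<inter> unit_level_set)
    = {q. \<bar>q $ 3\<bar> = height T (cyl_radius q)}"
proof (intro equalityI subsetI)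
  fix p assume "p \<in> (fst \<circ> hamiltonian_flow max_hamiltonian T) ` (Ann_TH (2 * T / pi) \<inter> unit_level_set)"
  then obtain w where w: "w \<in> Ann_TH (2 * T / pi) \<inter> unit_level_set"
    and p: "p = fst (hamiltonian_flow max_hamiltonian T w)"
    by auto
  from w obtain x0 y0 \<omega> where w_eq: "w = (vector [x0, y0, 0], blinfun_inner_right (vector [0, 0, \<omega>]))"
    and \<omega>: "\<omega>\<^sup>2 * (x0\<^sup>2 + y0\<^sup>2) = 4" and ge: "2 * T / pi \<le> sqrt (x0\<^sup>2 + y0\<^sup>2)"
    by (rule conormal_cases)
  define r where "r = sqrt (x0\<^sup>2 + y0\<^sup>2)"
  have r: "2 * T / pi \<le> r" "x0\<^sup>2 + y0\<^sup>2 = r\<^sup>2"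
    using ge by (simp_all add: r_def)
  \<comment> \<open>The level condition makes \<open>\<omega> * r / 2\<close> a sign: the two unit
    conormals over a point launch arcs turning in opposite senses.\<close>
  define \<sigma> where "\<sigma> = \<omega> * r / 2"
  have \<sigma>: "\<sigma>\<^sup>2 = 1"
    using \<omega> r by (simp add: \<sigma>_def power_divide power_mult_distrib)
  have \<omega>_eq: "\<omega> = 2 * \<sigma> / r"
    using launch_angle_bounds(1) [OF assms r(1)] by (simp add: \<sigma>_def)
  have "p = vector [arc_x x0 y0 \<omega> T, arc_y x0 y0 \<omega> T, arc_z x0 y0 \<omega> T]"
    using hamiltonian_flow_conormal [OF _ \<omega>] assms p w_eq by simp
  then have c: "cyl_radius p = r * cos (T / r)" and "p $ 3 = \<sigma> * height T (cyl_radius p)"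
    using arc_end [OF assms r \<sigma> \<omega>_eq] by (simp_all add: cyl_radius_def)
  then show "p \<in> {q. \<bar>q $ 3\<bar> = height T (cyl_radius q)}"
    using \<sigma> height_pos [OF assms cyl_radius_nonneg, of p] by (auto simp: sign_cases abs_mult)
next
  fix q :: "real^3" assume "q \<in> {q. \<bar>q $ 3\<bar> = height T (cyl_radius q)}"
  then have q: "\<bar>q $ 3\<bar> = height T (cyl_radius q)"
    by simp
  define r where "r = launch_radius T (cyl_radius q)"
  obtain \<sigma> :: real where \<sigma>: "\<sigma>\<^sup>2 = 1" "q $ 3 = \<sigma> * height T (cyl_radius q)"
    using that [of "if q $ 3 \<ge> 0 then 1 else -1"] by (simp flip: q)
  define \<omega> where "\<omega> = 2 * \<sigma> / r"
  have r: "2 * T / pi \<le> r"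
    using launch_radius_ge [OF assms cyl_radius_nonneg] by (simp add: r_def)
  then have "r > 0"
    by (rule launch_angle_bounds(1) [OF assms])
  obtain x0 y0 where xy0: "x0\<^sup>2 + y0\<^sup>2 = r\<^sup>2"
    and fin: "arc_x x0 y0 \<omega> T = q $ 1" "arc_y x0 y0 \<omega> T = q $ 2"
      "arc_z x0 y0 \<omega> T = \<sigma> * height T (cyl_radius q)"
    using arc_through [OF assms cyl_radius_def r_def \<sigma>(1) \<omega>_def] .
  have \<omega>: "\<omega>\<^sup>2 * (x0\<^sup>2 + y0\<^sup>2) = 4"
    using \<open>r > 0\<close> \<sigma>(1) by (simp add: xy0 \<omega>_def power_divide power_mult_distrib)
  let ?w = "(vector [x0, y0, 0], blinfun_inner_right (vector [0, 0, \<omega>])) :: cotangent"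
  have "?w \<in> Ann_TH (2 * T / pi) \<inter> unit_level_set"
    using \<open>r > 0\<close> r by (intro conormalI \<omega>) (simp add: xy0)
  moreover have "(fst \<circ> hamiltonian_flow max_hamiltonian T) ?w = q"
    using hamiltonian_flow_conormal [OF _ \<omega>, of T] assms
    by (simp add: fin vec_eq_iff forall_3 \<sigma>(2))
  ultimately show "q \<in> (fst \<circ> hamiltonian_flow max_hamiltonian T) ` (Ann_TH (2 * T / pi) \<inter> unit_level_set)"
    by (metis imageI)
qed

theorem proposition5p26:
  fixes T :: real
  assumes "T > 0"
  shows "card (components (frontier (attainable_set plane_H T))) = 2 \<and>
    (\<forall>C \<in> components (frontier (attainable_set plane_H T)).
      \<exists>f. continuous_on UNIV f \<and> smooth_on f (UNIV - {0}) \<and> C = graph_over_H f) \<and>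
    frontier (attainable_set plane_H T) =
      (fst \<circ> hamiltonian_flow max_hamiltonian T) ` (Ann_TH (2 * T / pi) \<inter> unit_level_set)"
proof -
  define f where "f p = height T (norm p)" for p :: "real^2"
  let ?A = "graph_over_H f" and ?B = "graph_over_H (\<lambda>p. - f p)"
  have cont: "continuous_on UNIV f" "continuous_on UNIV (\<lambda>p. - f p)"
    unfolding f_def by (intro continuous_intros continuous_on_height_norm assms)+
  have smooth: "smooth_on f (UNIV - {0})"
    unfolding f_def by (rule smooth_on_height_norm [OF assms])
  then have smooth': "smooth_on (\<lambda>p. - f p) (UNIV - {0})"
    by (auto simp: smooth_on_def open_delete intro: Ck_on_minus)
  have f_pos: "f p > 0" for p
    unfolding f_def by (rule height_pos [OF assms norm_ge_zero])
  \<comment> \<open>The equation \<open>\<bar>z\<bar> = f\<close> splits into \<open>z = f\<close>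
    and \<open>z = - f\<close>, since \<open>f\<close> is positive; the same positivity keeps the
    graphs disjoint.\<close>
  have frontier: "frontier (attainable_set plane_H T) = ?A \<union> ?B"
    using f_pos unfolding frontier_attainable_set [OF assms] graph_over_H_def cyl_radius_eq_norm
    by (auto simp: f_def abs_if) (metis less_asym neg_less_0_iff_less)+
  have "q \<notin> ?B" if "q \<in> ?A" for q
    using that f_pos [of "vector [q $ 1, q $ 2]"] by (simp add: graph_over_H_def)
  then have disjoint: "?A \<inter> ?B = {}"
    by blast
  then have "?A \<noteq> ?B"
    using graph_over_H_nonempty by (metis Int_absorb)
  moreover have "components (?A \<union> ?B) = {?A, ?B}"
    by (intro components_Un_closed closed_graph_over_H connected_graph_over_H graph_over_H_nonempty
        cont disjoint)
  ultimately show ?thesis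
    unfolding flow_image_conormal [OF assms] frontier_attainable_set [OF assms, symmetric]
    unfolding frontier using cont smooth smooth' by (auto simp: card_2_iff)
qed

end
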